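(* (Bi-monotone central limit theorem) Let $(A,\Phi)$ be a noncommutative probability space and let $b^{(j)}=(b^{(j)}_n)_{n=1}^{\infty}$, $j\in\{\mathfrak l,\mathfrak r\}$, be sequences of elements of $A$ such that \begin{itemize} \item each $b^{(j)}_n$ is centered, i.e. $\Phi(b^{(j)}_n)=0$; \item the sequence of pairs $(b_n^{(\mathfrak l)},b_n^{(\mathfrak r)})_{n\in\mathbb N}$ is bi-monotonely independent; \item the pairs $(b_n^{(\mathfrak l)},b_n^{(\mathfrak r)})$ have the same distribution for all $n\in\mathbb N$. \end{itemize} Put $c_{p,q}:=\Phi(b_n^{(p)}b_n^{(q)})$ for $p,q\in\{\mathfrak l,\mathfrak r\}$ and $S_N(b^{(j)}):=\sum_{n=1}^Nb_n^{(j)}$. Then for every pattern $\delta=(\delta_1,\ldots,\delta_{2n})\in\{\mathfrak l,\mathfrak r\}^{2n}$ we have $$\lim_{N\to\infty}\Phi\left(\frac{S_N(b^{(\delta_1)})}{N^{1/2}}\cdots\frac{S_N(b^{(\delta_{2n})})}{N^{1/2}}\right)=\frac{1}{n!}\sum_{\pi\in\mathrm{PP}_{\bowtie}(\delta)}\ \prod_{\{k<l\}\in\pi}c_{\delta_k,\delta_l}.$$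
   Context: An ordered two-faced partition of a set $X$ is a partition of $X$ into nonempty blocks with a total order $\le$ on the set of blocks, together with a map $\delta\colon X\to\{\mathfrak l,\mathfrak r\}$ (the pattern), $x\mapsto\delta_x$; it is a pair partition if all blocks have exactly two elements. For totally ordered $X$ it is called bi-monotone if for all $a<b<c$ in $X$ and blocks $V,W$ with $a,c\in V$, $b\in W$: $V\ge W$ if $\delta(b)=\mathfrak r$ and $V\le W$ if $\delta(b)=\mathfrak l$. $\mathrm{PP}_{\bowtie}(\delta)$ is the set of all bi-monotone (ordered) pair partitions of $\{1,\ldots,2n\}$ with pattern $\delta$; the same underlying partition with different block orders counts as different elements. The product over $\{k<l\}\in\pi$ runs over the blocks $\{k,l\}$ of $\pi$ with $k<l$. The distribution of a pair $(b^{(\mathfrak l)},b^{(\mathfrak r)})$ is the collection of its moments $\Phi(b^{(\delta_1)}\cdots b^{(\delta_m)})$, $m\in\mathbb N$, $\delta\in\{\mathfrak l,\mathfrak r\}^m$. An infinite sequence of pairs is bi-monotonely independent if for every $n$ the first $n$ pairs are bi-monotonely independent in the given order. Bi-monotone independence: algebras are complex and associative, not necessarily unital; $\sqcup$ is the free product of (not necessarily unital) algebras; $\widetilde B=\mathbb C1\oplus B$ is the unitization (a new unit is adjoined); inner products are linear in the second argument. A noncommutative probability space is a unital $*$-algebra $A$ with a state $\Phi$. A two-faced $*$-algebra is a $*$-algebra $B=B^{\mathfrak l}\sqcup B^{\mathfrak r}$. A two-faced random variable is a $*$-homomorphism $j\colon B\to A$ with $B$ a two-faced $*$-algebra; $\widetilde{\jmath}\colon\widetilde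 B\to A$ is its unital extension. A pair $(b^{\mathfrak l},b^{\mathfrak r})\in A\times A$ is regarded as the two-faced random variable $\operatorname{*-alg}(b^{\mathfrak l})\sqcup\operatorname{*-alg}(b^{\mathfrak r})\to A$ restricting to the inclusions, where $\operatorname{*-alg}(b)$ is the (not necessarily unital) $*$-subalgebra generated by $b$. A pointed representation of an algebra is a homomorphism $\pi$ to the linear operators on a pre-Hilbert space $H$ with a unit vector $\Omega$; $P$ is the orthogonal projection onto $\mathbb C\Omega$. For pointed representations $\pi_k$ of two-faced algebras $B_k$ on $(H_k,\Omega_k)$, $k=1,\dots,n$, the representation $\pi_1\bowtie\cdots\bowtie\pi_n$ of $B_1\sqcup\cdots\sqcup B_n$ on $H_1\otimes\cdots\otimes H_n$ is determined by $a\mapsto P^{\otimes k-1}\otimes\pi_k(a)\otimes\mathrm{id}^{\otimes n-k}$ for $a\in B_k^{\mathfrak l}$ and $a\mapsto\mathrm{id}^{\otimes k-1}\otimes\pi_k(a)\otimes P^{\otimes n-k}$ for $a\in B_k^{\mathfrak r}$. For states $\varphi_k$ on $\widetilde B_k$, choose pointed $*$-representations $\pi_k$ of $B_k$ with $\varphi_k(b)=\langle\Omega_k,\pi_k(b)\Omega_k\rangle$; then $\varphi_1\bowtie\cdots\bowtie\varphi_n$ is the state on the unitization of $B_1\sqcup\cdots\sqcup B_n$ equal to $1$ at $1$ and to $a\mapsto\langle\Omega_1\otimes\cdots\otimes\Omega_n,(\pi_1\bowtie\cdots\bowtie\pi_n)(a)\,\Omega_1\otimes\cdots\otimes\Omega_n\rangle$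 on $B_1\sqcup\cdots\sqcup B_n$ (independent of the choice of the $\pi_k$). Two-faced random variables $j_1,\ldots,j_n$ are bi-monotonely independent (in this order) if $\Phi\circ\widetilde{j_1\sqcup\cdots\sqcup j_n}=(\Phi\circ\widetilde{\jmath}_1)\bowtie\cdots\bowtie(\Phi\circ\widetilde{\jmath}_n)$; pairs of elements are bi-monotonely independent if the associated two-faced random variables are. *)

theory Defs
  imports
    Complex_Main
    "HOL-Library.Poly_Mapping"
    "HOL-Library.Disjoint_Sets"
    "HOL-Library.Nonpos_Ints"
    "HOL-Library.FuncSet"
    "HOL-Algebra.Module"
begin

section \<open>Complex vector spaces, star-algebras, states\<close>

definition complex_field :: "complex ring" where
  "complex_field = \<lparr>carrier = UNIV, mult = (*), one = 1, zero = 0, add = (+)\<rparr>"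

text \<open>
  A complex vector space is a \<^term>\<open>module complex_field V\<close>.  The record type of modules extends that
  of rings, so it has fields \<^term>\<open>mult\<close> and \<^term>\<open>one\<close>: a vector space uses neither, a
  not necessarily unital algebra does not use \<^term>\<open>one\<close>.
\<close>

record 'a star_algebra = "(complex, 'a) module" +
  star :: "'a \<Rightarrow> 'a"

locale star_algebra = module complex_field B for B (structure) +
  assumes mult_closed: "x \<in> carrier B \<Longrightarrow> y \<in> carrier B \<Longrightarrow> x \<otimes> y \<in> carrier B"
    and mult_assoc: "x \<in> carrier B \<Longrightarrow> y \<in> carrier B \<Longrightarrow> z \<in> carrier B \<Longrightarrow> (x \<otimes> y) \<otimes> z = x \<otimes> (y \<otimes> z)"
    and mult_l_distr: "x \<in> carrier B \<Longrightarrow> y \<in> carrier B \<Longrightarrow> z \<in> carrier B \<Longrightarrow> (x \<oplus> y) \<otimes> z = x \<otimes> z \<oplus> y \<otimes> z"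
    and mult_r_distr: "x \<in> carrier B \<Longrightarrow> y \<in> carrier B \<Longrightarrow> z \<in> carrier B \<Longrightarrow> z \<otimes> (x \<oplus> y) = z \<otimes> x \<oplus> z \<otimes> y"
    and smult_mult_l: "x \<in> carrier B \<Longrightarrow> y \<in> carrier B \<Longrightarrow> (c \<odot> x) \<otimes> y = c \<odot> (x \<otimes> y)"
    and smult_mult_r: "x \<in> carrier B \<Longrightarrow> y \<in> carrier B \<Longrightarrow> x \<otimes> (c \<odot> y) = c \<odot> (x \<otimes> y)"
    and star_closed: "x \<in> carrier B \<Longrightarrow> star B x \<in> carrier B"
    and star_star: "x \<in> carrier B \<Longrightarrow> star B (star B x) = x"
    and star_add: "x \<in> carrier B \<Longrightarrow> y \<in> carrier B \<Longrightarrow> star B (x \<oplus> y) = star B x \<oplus> star B y"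
    and star_smult: "x \<in> carrier B \<Longrightarrow> star B (c \<odot> x) = cnj c \<odot> star B x"
    and star_mult: "x \<in> carrier B \<Longrightarrow> y \<in> carrier B \<Longrightarrow> star B (x \<otimes> y) = star B y \<otimes> star B x"

locale unital_star_algebra = star_algebra B + monoid B for B (structure)

definition state :: "'a star_algebra \<Rightarrow> ('a \<Rightarrow> complex) \<Rightarrow> bool" where
  "state A \<Phi> \<longleftrightarrow>
     (\<forall>x\<in>carrier A. \<forall>y\<in>carrier A. \<Phi> (x \<oplus>\<^bsub>A\<^esub> y) = \<Phi> x + \<Phi> y) \<and>
     (\<forall>c. \<forall>x\<in>carrier A. \<Phi> (c \<odot>\<^bsub>A\<^esub> x) = c * \<Phi> x) \<and>
     \<Phi> \<one>\<^bsub>A\<^esub> = 1 \<and>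
     (\<forall>x\<in>carrier A. \<Phi> (star A x \<otimes>\<^bsub>A\<^esub> x) \<in> \<real>\<^sub>\<ge>\<^sub>0)"

definition nc_probability_space :: "'a star_algebra \<Rightarrow> ('a \<Rightarrow> complex) \<Rightarrow> bool" where
  "nc_probability_space A \<Phi> \<longleftrightarrow> unital_star_algebra A \<and> state A \<Phi>"

definition linear_map ::
    "(complex, 'v, 'm) module_scheme \<Rightarrow> (complex, 'w, 'k) module_scheme \<Rightarrow> ('v \<Rightarrow> 'w) \<Rightarrow> bool" where
  "linear_map V W f \<longleftrightarrow>
     (\<forall>x\<in>carrier V. f x \<in> carrier W) \<and>
     (\<forall>x\<in>carrier V. \<forall>y\<in>carrier V. f (x \<oplus>\<^bsub>V\<^esub> y) = f x \<oplus>\<^bsub>W\<^esub> f y) \<and>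
     (\<forall>c. \<forall>x\<in>carrier V. f (c \<odot>\<^bsub>V\<^esub> x) = c \<odot>\<^bsub>W\<^esub> f x)"

definition algebra_hom :: "'a star_algebra \<Rightarrow> 'b star_algebra \<Rightarrow> ('a \<Rightarrow> 'b) \<Rightarrow> bool" where
  "algebra_hom B C f \<longleftrightarrow> linear_map B C f \<and>
     (\<forall>x\<in>carrier B. \<forall>y\<in>carrier B. f (x \<otimes>\<^bsub>B\<^esub> y) = f x \<otimes>\<^bsub>C\<^esub> f y)"

definition star_hom :: "'a star_algebra \<Rightarrow> 'b star_algebra \<Rightarrow> ('a \<Rightarrow> 'b) \<Rightarrow> bool" where
  "star_hom B C f \<longleftrightarrow> algebra_hom B C f \<and> (\<forall>x\<in>carrier B. f (star B x) = star C (f x))"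

text \<open>The not necessarily unital star-subalgebra generated by one element (as a set).\<close>

inductive_set star_generated :: "'a star_algebra \<Rightarrow> 'a \<Rightarrow> 'a set" for A b where
  generator: "b \<in> star_generated A b"
| add: "x \<in> star_generated A b \<Longrightarrow> y \<in> star_generated A b \<Longrightarrow> x \<oplus>\<^bsub>A\<^esub> y \<in> star_generated A b"
| smult: "x \<in> star_generated A b \<Longrightarrow> c \<odot>\<^bsub>A\<^esub> x \<in> star_generated A b"
| mult: "x \<in> star_generated A b \<Longrightarrow> y \<in> star_generated A b \<Longrightarrow> x \<otimes>\<^bsub>A\<^esub> y \<in> star_generated A b"
| star: "x \<in> star_generated A b \<Longrightarrow> star A x \<in> star_generated A b"

text \<open>The pair \<^term>\<open>(c, x)\<close> stands for c1 + x in the direct sum of C1 and B.\<close>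

definition unitization :: "'b star_algebra \<Rightarrow> (complex \<times> 'b) star_algebra" where
  "unitization B = \<lparr>carrier = UNIV \<times> carrier B,
     mult = (\<lambda>(c, x) (d, y). (c * d, (c \<odot>\<^bsub>B\<^esub> y \<oplus>\<^bsub>B\<^esub> d \<odot>\<^bsub>B\<^esub> x) \<oplus>\<^bsub>B\<^esub> x \<otimes>\<^bsub>B\<^esub> y)),
     one = (1, \<zero>\<^bsub>B\<^esub>),
     zero = (0, \<zero>\<^bsub>B\<^esub>),
     add = (\<lambda>(c, x) (d, y). (c + d, x \<oplus>\<^bsub>B\<^esub> y)),
     smult = (\<lambda>c (d, y). (c * d, c \<odot>\<^bsub>B\<^esub> y)),
     star = (\<lambda>(c, x). (cnj c, star B x))\<rparr>"

definition unital_extension :: "'a star_algebra \<Rightarrow> ('b \<Rightarrow> 'a) \<Rightarrow> complex \<times> 'b \<Rightarrow> 'a" where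
  "unital_extension A j = (\<lambda>(c, x). c \<odot>\<^bsub>A\<^esub> \<one>\<^bsub>A\<^esub> \<oplus>\<^bsub>A\<^esub> j x)"


section \<open>Quotients of spaces of formal linear combinations\<close>

definition formal_smult :: "complex \<Rightarrow> ('x \<Rightarrow>\<^sub>0 complex) \<Rightarrow> ('x \<Rightarrow>\<^sub>0 complex)" where
  "formal_smult c f = Poly_Mapping.map ((*) c) f"

definition formal_span :: "('x \<Rightarrow>\<^sub>0 complex) set \<Rightarrow> ('x \<Rightarrow>\<^sub>0 complex) set" where
  "formal_span S = Modules.module.span formal_smult S"

definition residue_class :: "('x \<Rightarrow>\<^sub>0 complex) set \<Rightarrow> ('x \<Rightarrow>\<^sub>0 complex) \<Rightarrow> ('x \<Rightarrow>\<^sub>0 complex) set" where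
  "residue_class K f = {g. g - f \<in> K}"

text \<open>Every operation below that is defined through \<^term>\<open>rep\<close> is independent of the representative.\<close>

definition rep :: "('x \<Rightarrow>\<^sub>0 complex) set \<Rightarrow> ('x \<Rightarrow>\<^sub>0 complex)" where
  "rep X = (SOME f. f \<in> X)"


section \<open>The free product of algebras\<close>

text \<open>
  With concatenation of words as addition of exponents, \<^typ>\<open>'x list \<Rightarrow>\<^sub>0 complex\<close> with its
  multiplication from \<^theory>\<open>HOL-Library.Poly_Mapping\<close> is the free unital algebra over \<^typ>\<open>'x\<close>.
\<close>

instantiation list :: (type) monoid_add
begin
definition zero_list :: "'a list" where "zero_list = []"
definition plus_list :: "'a list \<Rightarrow> 'a list \<Rightarrow> 'a list" where "plus_list = append"
instance by standard (simp_all add: zero_list_def plus_list_def)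
end

type_synonym ('i, 'b) free_elem = "(('i \<times> 'b) list \<Rightarrow>\<^sub>0 complex) set"

definition words :: "'i set \<Rightarrow> ('i \<Rightarrow> 'b star_algebra) \<Rightarrow> ('i \<times> 'b) list set" where
  "words I B = lists (Sigma I (\<lambda>i. carrier (B i)))"

definition free_relators ::
    "'i set \<Rightarrow> ('i \<Rightarrow> 'b star_algebra) \<Rightarrow> (('i \<times> 'b) list \<Rightarrow>\<^sub>0 complex) set" where
  "free_relators I B =
     {Poly_Mapping.single [(i, x \<oplus>\<^bsub>B i\<^esub> y)] 1 - Poly_Mapping.single [(i, x)] 1 - Poly_Mapping.single [(i, y)] 1
       | i x y. i \<in> I \<and> x \<in> carrier (B i) \<and> y \<in> carrier (B i)} \<union>
     {Poly_Mapping.single [(i, c \<odot>\<^bsub>B i\<^esub> x)] 1 - Poly_Mapping.single [(i, x)] c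
       | i c x. i \<in> I \<and> x \<in> carrier (B i)} \<union>
     {Poly_Mapping.single [(i, x \<otimes>\<^bsub>B i\<^esub> y)] 1 - Poly_Mapping.single [(i, x), (i, y)] 1
       | i x y. i \<in> I \<and> x \<in> carrier (B i) \<and> y \<in> carrier (B i)}"

definition free_ideal ::
    "'i set \<Rightarrow> ('i \<Rightarrow> 'b star_algebra) \<Rightarrow> (('i \<times> 'b) list \<Rightarrow>\<^sub>0 complex) set" where
  "free_ideal I B = formal_span
     {Poly_Mapping.single u 1 * r * Poly_Mapping.single v 1
       | u r v. u \<in> words I B \<and> v \<in> words I B \<and> r \<in> free_relators I B}"

definition formal_star ::
    "('i \<Rightarrow> 'b star_algebra) \<Rightarrow> (('i \<times> 'b) list \<Rightarrow>\<^sub>0 complex) \<Rightarrow> (('i \<times> 'b) list \<Rightarrow>\<^sub>0 complex)" where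
  "formal_star B f = (\<Sum>w\<in>Poly_Mapping.keys f.
     Poly_Mapping.single (rev (map (\<lambda>(i, x). (i, star (B i) x)) w)) (cnj (Poly_Mapping.lookup f w)))"

text \<open>Only nonempty words occur, since the free product is the one of not necessarily unital algebras.\<close>

definition free_product ::
    "'i set \<Rightarrow> ('i \<Rightarrow> 'b star_algebra) \<Rightarrow> ('i, 'b) free_elem star_algebra" where
  "free_product I B = (let K = free_ideal I B in
     \<lparr>carrier = residue_class K ` {f. Poly_Mapping.keys f \<subseteq> words I B - {[]}},
      mult = (\<lambda>X Y. residue_class K (rep X * rep Y)),
      one = undefined,
      zero = residue_class K 0,
      add = (\<lambda>X Y. residue_class K (rep X + rep Y)),
      smult = (\<lambda>c X. residue_class K (formal_smult c (rep X))),
      star = (\<lambda>X. residue_class K (formal_star B (rep X)))\<rparr>)"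

definition free_inclusion ::
    "'i set \<Rightarrow> ('i \<Rightarrow> 'b star_algebra) \<Rightarrow> 'i \<Rightarrow> 'b \<Rightarrow> ('i, 'b) free_elem" where
  "free_inclusion I B i x = residue_class (free_ideal I B) (Poly_Mapping.single [(i, x)] 1)"

text \<open>
  \<^term>\<open>J\<close> is the homomorphism on the free product that extends the homomorphisms \<^term>\<open>j i\<close>
  (it exists and is determined on the carrier by the universal property).
\<close>

definition is_free_lift ::
    "'i set \<Rightarrow> ('i \<Rightarrow> 'b star_algebra) \<Rightarrow> 'c star_algebra \<Rightarrow> ('i \<Rightarrow> 'b \<Rightarrow> 'c) \<Rightarrow>
     (('i, 'b) free_elem \<Rightarrow> 'c) \<Rightarrow> bool" where
  "is_free_lift I B C j J \<longleftrightarrow> algebra_hom (free_product I B) C J \<and>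
     (\<forall>i\<in>I. \<forall>x\<in>carrier (B i). J (free_inclusion I B i x) = j i x)"


section \<open>Pre-Hilbert spaces, representations, tensor products\<close>

record 'h prehilbert = "(complex, 'h) module" +
  inner :: "'h \<Rightarrow> 'h \<Rightarrow> complex"

locale prehilbert_space = module complex_field H for H (structure) +
  assumes inner_add_right: "u \<in> carrier H \<Longrightarrow> v \<in> carrier H \<Longrightarrow> w \<in> carrier H \<Longrightarrow>
      inner H u (v \<oplus> w) = inner H u v + inner H u w"
    and inner_smult_right: "u \<in> carrier H \<Longrightarrow> v \<in> carrier H \<Longrightarrow> inner H u (c \<odot> v) = c * inner H u v"
    and inner_commute: "u \<in> carrier H \<Longrightarrow> v \<in> carrier H \<Longrightarrow> inner H v u = cnj (inner H u v)"
    and inner_ge_zero: "u \<in> carrier H \<Longrightarrow> inner H u u \<in> \<real>\<^sub>\<ge>\<^sub>0"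
    and inner_eq_zero: "u \<in> carrier H \<Longrightarrow> inner H u u = 0 \<Longrightarrow> u = \<zero>"

definition representation ::
    "'b star_algebra \<Rightarrow> 'h prehilbert \<Rightarrow> ('b \<Rightarrow> 'h \<Rightarrow> 'h) \<Rightarrow> bool" where
  "representation B H \<pi> \<longleftrightarrow>
     (\<forall>x\<in>carrier B. linear_map H H (\<pi> x)) \<and>
     (\<forall>x\<in>carrier B. \<forall>y\<in>carrier B. \<forall>v\<in>carrier H. \<pi> (x \<oplus>\<^bsub>B\<^esub> y) v = \<pi> x v \<oplus>\<^bsub>H\<^esub> \<pi> y v) \<and>
     (\<forall>c. \<forall>x\<in>carrier B. \<forall>v\<in>carrier H. \<pi> (c \<odot>\<^bsub>B\<^esub> x) v = c \<odot>\<^bsub>H\<^esub> \<pi> x v) \<and>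
     (\<forall>x\<in>carrier B. \<forall>y\<in>carrier B. \<forall>v\<in>carrier H. \<pi> (x \<otimes>\<^bsub>B\<^esub> y) v = \<pi> x (\<pi> y v))"

definition pointed_star_representation ::
    "'b star_algebra \<Rightarrow> 'h prehilbert \<Rightarrow> 'h \<Rightarrow> ('b \<Rightarrow> 'h \<Rightarrow> 'h) \<Rightarrow> bool" where
  "pointed_star_representation B H \<Omega> \<pi> \<longleftrightarrow>
     prehilbert_space H \<and> \<Omega> \<in> carrier H \<and> inner H \<Omega> \<Omega> = 1 \<and> representation B H \<pi> \<and>
     (\<forall>x\<in>carrier B. \<forall>u\<in>carrier H. \<forall>v\<in>carrier H. inner H u (\<pi> x v) = inner H (\<pi> (star B x) u) v)"

text \<open>The orthogonal projection onto the span of a unit vector \<^term>\<open>\<Omega>\<close>.\<close>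

definition vacuum_projection :: "'h prehilbert \<Rightarrow> 'h \<Rightarrow> 'h \<Rightarrow> 'h" where
  "vacuum_projection H \<Omega> v = inner H \<Omega> v \<odot>\<^bsub>H\<^esub> \<Omega>"

text \<open>
  The algebraic tensor product of a family indexed by a finite set \<^term>\<open>I\<close>: formal linear
  combinations of tuples modulo multilinearity.
\<close>

type_synonym ('i, 'h) tensor = "(('i \<Rightarrow> 'h) \<Rightarrow>\<^sub>0 complex) set"

definition tensor_tuples :: "'i set \<Rightarrow> ('i \<Rightarrow> 'h prehilbert) \<Rightarrow> ('i \<Rightarrow> 'h) set" where
  "tensor_tuples I H = (\<Pi>\<^sub>E i\<in>I. carrier (H i))"

definition tensor_relations ::
    "'i set \<Rightarrow> ('i \<Rightarrow> 'h prehilbert) \<Rightarrow> (('i \<Rightarrow> 'h) \<Rightarrow>\<^sub>0 complex) set" where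
  "tensor_relations I H = formal_span (
     {Poly_Mapping.single (v(i := x \<oplus>\<^bsub>H i\<^esub> y)) 1
        - Poly_Mapping.single (v(i := x)) 1 - Poly_Mapping.single (v(i := y)) 1
       | v i x y. v \<in> tensor_tuples I H \<and> i \<in> I \<and> x \<in> carrier (H i) \<and> y \<in> carrier (H i)} \<union>
     {Poly_Mapping.single (v(i := c \<odot>\<^bsub>H i\<^esub> x)) 1 - Poly_Mapping.single (v(i := x)) c
       | v i c x. v \<in> tensor_tuples I H \<and> i \<in> I \<and> x \<in> carrier (H i)})"

definition elementary_tensor ::
    "'i set \<Rightarrow> ('i \<Rightarrow> 'h prehilbert) \<Rightarrow> ('i \<Rightarrow> 'h) \<Rightarrow> ('i, 'h) tensor" where
  "elementary_tensor I H v = residue_class (tensor_relations I H) (Poly_Mapping.single (restrict v I) 1)"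

definition formal_inner ::
    "'i set \<Rightarrow> ('i \<Rightarrow> 'h prehilbert) \<Rightarrow> (('i \<Rightarrow> 'h) \<Rightarrow>\<^sub>0 complex) \<Rightarrow> (('i \<Rightarrow> 'h) \<Rightarrow>\<^sub>0 complex) \<Rightarrow> complex" where
  "formal_inner I H f g = (\<Sum>u\<in>Poly_Mapping.keys f. \<Sum>v\<in>Poly_Mapping.keys g.
     cnj (Poly_Mapping.lookup f u) * Poly_Mapping.lookup g v * (\<Prod>i\<in>I. inner (H i) (u i) (v i)))"

definition tensor_product ::
    "'i set \<Rightarrow> ('i \<Rightarrow> 'h prehilbert) \<Rightarrow> ('i, 'h) tensor prehilbert" where
  "tensor_product I H = (let K = tensor_relations I H in
     \<lparr>carrier = residue_class K ` {f. Poly_Mapping.keys f \<subseteq> tensor_tuples I H},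
      mult = undefined,
      one = undefined,
      zero = residue_class K 0,
      add = (\<lambda>X Y. residue_class K (rep X + rep Y)),
      smult = (\<lambda>c X. residue_class K (formal_smult c (rep X))),
      inner = (\<lambda>X Y. formal_inner I H (rep X) (rep Y))\<rparr>)"

text \<open>\<^term>\<open>S\<close> is the tensor product of the operators \<^term>\<open>T i\<close>.\<close>

definition is_tensor_operator ::
    "'i set \<Rightarrow> ('i \<Rightarrow> 'h prehilbert) \<Rightarrow> ('i \<Rightarrow> 'h \<Rightarrow> 'h) \<Rightarrow> (('i, 'h) tensor \<Rightarrow> ('i, 'h) tensor) \<Rightarrow> bool" where
  "is_tensor_operator I H T S \<longleftrightarrow> linear_map (tensor_product I H) (tensor_product I H) S \<and>
     (\<forall>v\<in>tensor_tuples I H. S (elementary_tensor I H v) = elementary_tensor I H (\<lambda>i. T i (v i)))"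


section \<open>Bi-monotone independence\<close>

datatype face = Left | Right

text \<open>
  A two-faced algebra is given by its two faces; the algebra itself is their free product.
\<close>

type_synonym 'b two_faced_elem = "(face, 'b) free_elem"

abbreviation two_faced_algebra :: "(face \<Rightarrow> 'b star_algebra) \<Rightarrow> 'b two_faced_elem star_algebra" where
  "two_faced_algebra B \<equiv> free_product UNIV B"

definition two_faced_random_variable ::
    "'a star_algebra \<Rightarrow> (face \<Rightarrow> 'b star_algebra) \<Rightarrow> ('b two_faced_elem \<Rightarrow> 'a) \<Rightarrow> bool" where
  "two_faced_random_variable A B j \<longleftrightarrow>
     (\<forall>p. star_algebra (B p)) \<and> star_hom (two_faced_algebra B) A j"

text \<open>
  The operator on the \<^term>\<open>i\<close>-th leg of \<open>P\<^bsup>\<otimes>k-1\<^esup> \<otimes> T \<otimes> id\<^bsup>\<otimes>n-k\<^esup>\<close> for the left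
  and of \<open>id\<^bsup>\<otimes>k-1\<^esup> \<otimes> T \<otimes> P\<^bsup>\<otimes>n-k\<^esup>\<close> for the right face.
\<close>

definition bimonotone_leg ::
    "(nat \<Rightarrow> 'h prehilbert) \<Rightarrow> (nat \<Rightarrow> 'h) \<Rightarrow> face \<Rightarrow> nat \<Rightarrow> ('h \<Rightarrow> 'h) \<Rightarrow> nat \<Rightarrow> 'h \<Rightarrow> 'h" where
  "bimonotone_leg H \<Omega> p k T i =
     (if i = k then T
      else if (case p of Left \<Rightarrow> i < k | Right \<Rightarrow> k < i) then vacuum_projection (H i) (\<Omega> i)
      else id)"

definition is_bimonotone_representation ::
    "nat \<Rightarrow> (nat \<Rightarrow> face \<Rightarrow> 'b star_algebra) \<Rightarrow> (nat \<Rightarrow> 'h prehilbert) \<Rightarrow> (nat \<Rightarrow> 'h) \<Rightarrow>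
     (nat \<Rightarrow> 'b two_faced_elem \<Rightarrow> 'h \<Rightarrow> 'h) \<Rightarrow>
     ((nat, 'b two_faced_elem) free_elem \<Rightarrow> (nat, 'h) tensor \<Rightarrow> (nat, 'h) tensor) \<Rightarrow> bool" where
  "is_bimonotone_representation n B H \<Omega> \<pi> \<rho> \<longleftrightarrow>
     (let F = (\<lambda>k. two_faced_algebra (B k)) in
      representation (free_product {1..n} F) (tensor_product {1..n} H) \<rho> \<and>
      (\<forall>k\<in>{1..n}. \<forall>p. \<forall>a\<in>carrier (B k p).
         let a' = free_inclusion UNIV (B k) p a in
         is_tensor_operator {1..n} H (bimonotone_leg H \<Omega> p k (\<pi> k a'))
           (\<rho> (free_inclusion {1..n} F k a'))))"

text \<open>
  \<^term>\<open>\<psi>\<close> is the bi-monotone product of the states \<^term>\<open>\<phi> k\<close> (on the carrier of the unitization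
  of the free product).  The pre-Hilbert spaces range over a fixed type; it suffices, since
  the GNS space of a state consists of subsets of the unitization, and \<^term>\<open>\<psi>\<close> does not depend
  on the chosen representations.
\<close>

definition is_bimonotone_product ::
    "nat \<Rightarrow> (nat \<Rightarrow> face \<Rightarrow> 'b star_algebra) \<Rightarrow> (nat \<Rightarrow> complex \<times> 'b two_faced_elem \<Rightarrow> complex) \<Rightarrow>
     (complex \<times> (nat, 'b two_faced_elem) free_elem \<Rightarrow> complex) \<Rightarrow> bool" where
  "is_bimonotone_product n B \<phi> \<psi> \<longleftrightarrow>
     (let F = (\<lambda>k. two_faced_algebra (B k)) in
      (\<forall>k\<in>{1..n}. state (unitization (F k)) (\<phi> k)) \<and>
      (\<exists>(H :: nat \<Rightarrow> (complex \<times> 'b two_faced_elem) set prehilbert) \<Omega> \<pi> \<rho>.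
         (\<forall>k\<in>{1..n}. pointed_star_representation (F k) (H k) (\<Omega> k) (\<pi> k) \<and>
            (\<forall>x\<in>carrier (F k). \<phi> k (0, x) = inner (H k) (\<Omega> k) (\<pi> k x (\<Omega> k)))) \<and>
         is_bimonotone_representation n B H \<Omega> \<pi> \<rho> \<and>
         (let vac = elementary_tensor {1..n} H \<Omega> in
          \<forall>c. \<forall>x\<in>carrier (free_product {1..n} F).
            \<psi> (c, x) = c + inner (tensor_product {1..n} H) vac (\<rho> x vac))))"

definition bimonotone_independent ::
    "'a star_algebra \<Rightarrow> ('a \<Rightarrow> complex) \<Rightarrow> nat \<Rightarrow> (nat \<Rightarrow> face \<Rightarrow> 'b star_algebra) \<Rightarrow>
     (nat \<Rightarrow> 'b two_faced_elem \<Rightarrow> 'a) \<Rightarrow> bool" where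
  "bimonotone_independent A \<Phi> n B j \<longleftrightarrow>
     (\<forall>k\<in>{1..n}. two_faced_random_variable A (B k) (j k)) \<and>
     (\<exists>J. is_free_lift {1..n} (\<lambda>k. two_faced_algebra (B k)) A j J \<and>
          is_bimonotone_product n B (\<lambda>k. \<Phi> \<circ> unital_extension A (j k)) (\<Phi> \<circ> unital_extension A J))"

definition pair_faces :: "'a star_algebra \<Rightarrow> (face \<Rightarrow> 'a) \<Rightarrow> face \<Rightarrow> 'a star_algebra" where
  "pair_faces A b p = A\<lparr>carrier := star_generated A (b p)\<rparr>"

text \<open>A pair is regarded as the two-faced random variable that restricts to the inclusions.\<close>

definition bimonotone_independent_pairs ::
    "'a star_algebra \<Rightarrow> ('a \<Rightarrow> complex) \<Rightarrow> nat \<Rightarrow> (nat \<Rightarrow> face \<Rightarrow> 'a) \<Rightarrow> bool" where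
  "bimonotone_independent_pairs A \<Phi> n b \<longleftrightarrow>
     (\<exists>j. (\<forall>k\<in>{1..n}. is_free_lift UNIV (pair_faces A (b k)) A (\<lambda>p a. a) (j k)) \<and>
          bimonotone_independent A \<Phi> n (\<lambda>k. pair_faces A (b k)) j)"

definition bimonotone_independent_sequence ::
    "'a star_algebra \<Rightarrow> ('a \<Rightarrow> complex) \<Rightarrow> (nat \<Rightarrow> face \<Rightarrow> 'a) \<Rightarrow> bool" where
  "bimonotone_independent_sequence A \<Phi> b \<longleftrightarrow> (\<forall>n\<ge>1. bimonotone_independent_pairs A \<Phi> n b)"


section \<open>Moments and bi-monotone pair partitions\<close>

definition list_product :: "'a star_algebra \<Rightarrow> 'a list \<Rightarrow> 'a" where
  "list_product A xs = foldr (\<otimes>\<^bsub>A\<^esub>) xs \<one>\<^bsub>A\<^esub>"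

definition pair_distribution ::
    "'a star_algebra \<Rightarrow> ('a \<Rightarrow> complex) \<Rightarrow> (face \<Rightarrow> 'a) \<Rightarrow> face list \<Rightarrow> complex" where
  "pair_distribution A \<Phi> b \<delta>s = \<Phi> (list_product A (map b \<delta>s))"

text \<open>An ordered partition is a pair \<^term>\<open>(P, r)\<close>, where \<^term>\<open>(V, W) \<in> r\<close> means \<open>V \<le> W\<close>.\<close>

definition ordered_partition :: "'x set \<Rightarrow> 'x set set \<Rightarrow> ('x set \<times> 'x set) set \<Rightarrow> bool" where
  "ordered_partition X P r \<longleftrightarrow> partition_on X P \<and> linear_order_on P r"

definition bimonotone_partition ::
    "('x::linorder \<Rightarrow> face) \<Rightarrow> 'x set set \<Rightarrow> ('x set \<times> 'x set) set \<Rightarrow> bool" where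
  "bimonotone_partition \<delta> P r \<longleftrightarrow>
     (\<forall>V\<in>P. \<forall>W\<in>P. \<forall>a\<in>V. \<forall>c\<in>V. \<forall>b\<in>W. a < b \<and> b < c \<longrightarrow>
        (\<delta> b = Right \<longrightarrow> (W, V) \<in> r) \<and> (\<delta> b = Left \<longrightarrow> (V, W) \<in> r))"

definition bimonotone_pair_partitions ::
    "nat \<Rightarrow> (nat \<Rightarrow> face) \<Rightarrow> (nat set set \<times> (nat set \<times> nat set) set) set" where
  "bimonotone_pair_partitions n \<delta> =
     {(P, r). ordered_partition {1..2 * n} P r \<and> (\<forall>V\<in>P. card V = 2) \<and> bimonotone_partition \<delta> P r}"

end

theory Submission
  imports Defs
begin

text \<open>
Expanding the product of the sums \<open>S\<^sub>N\<close> gives \<open>N\<^sup>-\<^sup>n\<close> times the sum of the joint moments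
\<open>\<Phi>(b\<^sub>k\<^sub>(\<^sub>1\<^sub>) \<dots> b\<^sub>k\<^sub>(\<^sub>2\<^sub>n\<^sub>))\<close> over all index functions \<open>k : {1..2n} \<rightarrow> {1..N}\<close>
(\<open>state_product_of_sums\<close>).

Bi-monotone independence realizes these moments as vacuum expectations on a tensor product.  There
each letter acts as a tensor product of operators, so the expectation is the product over the legs
\<open>i\<close> of one-leg expectations (\<open>joint_moment_factorizes\<close>).  On the leg \<open>i\<close> the letters with index
\<open>i\<close> act through the representation, the others by the vacuum projection or the identity.  The
one-leg expectation is therefore a function of the common moments of the pairs, computed
recursively by \<open>leg_moment\<close>: a vacuum projection cuts the word into independent factors.

Three consequences are used.  An index that occurs exactly once contributes a factor \<open>\<Phi>(b) = 0\<close>.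
An index that occurs at two places \<open>a < c\<close> contributes \<open>c\<^sub>\<delta>\<^sub>a\<^sub>,\<^sub>\<delta>\<^sub>c\<close> if no letter in between
projects its leg onto the vacuum, and \<open>0\<close> otherwise (\<open>leg_moment_pair\<close>); that no such letter exists
for any pair is exactly the bi-monotone condition on the partition into level sets of \<open>k\<close>, with
larger indices for smaller blocks (\<open>bimonotone_index_type_iff\<close>).  Finally, all moments are bounded
uniformly in \<open>k\<close> and \<open>N\<close> (\<open>norm_leg_moment_le\<close>).

The rest is counting (\<open>pair_index_sum_tendsto\<close>).  Functions with more than \<open>n\<close> values have an index
that occurs once, functions with fewer than \<open>n\<close> values are too few to survive the factor \<open>N\<^sup>-\<^sup>n\<close>, and
among those with \<open>n\<close> values only the ones with all level sets of size two remain.  Each ordered pair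
partition arises from \<open>N choose n\<close> functions, one for each possible image, and
\<open>(N choose n) / N\<^sup>n\<close> tends to \<open>1 / n!\<close>.
\<close>

section \<open>Formal linear combinations\<close>

lemma lookup_formal_smult [simp]:
  "Poly_Mapping.lookup (formal_smult c f) w = c * Poly_Mapping.lookup f w"
  by (simp add: formal_smult_def Poly_Mapping.map.rep_eq when_def)

lemma module_formal_smult: "Modules.module formal_smult"
  by standard (auto intro!: poly_mapping_eqI simp: lookup_add algebra_simps)

lemma keys_formal_smult: "Poly_Mapping.keys (formal_smult c f) \<subseteq> Poly_Mapping.keys f"
  by (auto simp: in_keys_iff)

lemma formal_span_subset:
  assumes "S \<subseteq> T" "0 \<in> T" "\<And>f g. f \<in> T \<Longrightarrow> g \<in> T \<Longrightarrow> f + g \<in> T"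
    "\<And>c f. f \<in> T \<Longrightarrow> formal_smult c f \<in> T"
  shows "formal_span S \<subseteq> T"
  unfolding formal_span_def
  by (rule module.span_minimal[OF module_formal_smult assms(1)])
    (use assms(2-) in \<open>auto simp: module.subspace_def[OF module_formal_smult]\<close>)

lemma zero_in_formal_span: "0 \<in> formal_span S"
  unfolding formal_span_def by (rule module.span_zero[OF module_formal_smult])

lemma rep_residue_class:
  assumes "0 \<in> K"
  shows "rep (residue_class K f) - f \<in> K"
proof -
  have "f \<in> residue_class K f" using assms by (simp add: residue_class_def)
  hence "rep (residue_class K f) \<in> residue_class K f" unfolding rep_def by (rule someI)
  thus ?thesis by (simp add: residue_class_def)
qed

section \<open>Free products\<close>

text \<open>
The algebra behind bi-monotone independence is a free product of free products.  Closure of the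
carrier is the property that passes from the factors to a free product and so can be iterated.
\<close>

definition closed_under_operations :: "'b star_algebra \<Rightarrow> bool" where
  "closed_under_operations B \<longleftrightarrow>
     (\<forall>x\<in>carrier B. \<forall>y\<in>carrier B. x \<oplus>\<^bsub>B\<^esub> y \<in> carrier B \<and> x \<otimes>\<^bsub>B\<^esub> y \<in> carrier B) \<and>
     (\<forall>c. \<forall>x\<in>carrier B. c \<odot>\<^bsub>B\<^esub> x \<in> carrier B)"

lemma star_algebra_closed_under_operations:
  assumes "star_algebra B" shows "closed_under_operations B"
proof -
  interpret star_algebra B by fact
  show ?thesis unfolding closed_under_operations_def
    by (auto simp: mult_closed complex_field_def intro: smult_closed[unfolded complex_field_def, simplified])
qed

lemma append_in_words: "u \<in> words I B \<Longrightarrow> v \<in> words I B \<Longrightarrow> u + v \<in> words I B"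
  by (simp add: words_def plus_list_def)

text \<open>
Every relator is a combination of words of length one and two, and closure of the factors keeps its
letters in the carriers.  Hence all representatives of an element of the free product are
combinations of nonempty words over the carriers, whichever one \<^term>\<open>rep\<close> selects.
\<close>

lemma free_ideal_keys:
  assumes "\<And>i. i \<in> I \<Longrightarrow> closed_under_operations (B i)" "f \<in> free_ideal I B"
  shows "Poly_Mapping.keys f \<subseteq> words I B - {[]}"
proof -
  let ?T = "{f :: ('a \<times> 'b) list \<Rightarrow>\<^sub>0 complex. Poly_Mapping.keys f \<subseteq> words I B - {[]}}"
  have rel: "Poly_Mapping.keys r \<subseteq> words I B - {[]}" if "r \<in> free_relators I B" for r
  proof -
    have s: "Poly_Mapping.keys (Poly_Mapping.single w d :: ('a \<times> 'b) list \<Rightarrow>\<^sub>0 complex) \<subseteq> words I B - {[]}"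
      if "w \<in> words I B" "w \<noteq> []" for w d
      using that by auto
    have d: "Poly_Mapping.keys (f - g) \<subseteq> words I B - {[]}" if "Poly_Mapping.keys f \<subseteq> words I B - {[]}"
      "Poly_Mapping.keys g \<subseteq> words I B - {[]}" for f g :: "('a \<times> 'b) list \<Rightarrow>\<^sub>0 complex"
      using that Poly_Mapping.keys_diff[of f g] by blast
    have cl: "i \<in> I \<Longrightarrow> x \<in> carrier (B i) \<Longrightarrow> y \<in> carrier (B i) \<Longrightarrow>
      x \<oplus>\<^bsub>B i\<^esub> y \<in> carrier (B i) \<and> x \<otimes>\<^bsub>B i\<^esub> y \<in> carrier (B i) \<and> c \<odot>\<^bsub>B i\<^esub> x \<in> carrier (B i)" for i x y c
      using assms(1)[of i] by (auto simp: closed_under_operations_def)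
    show ?thesis
      using that unfolding free_relators_def
      apply (elim UnE CollectE exE conjE; hypsubst)
      by (intro d s; simp add: words_def cl)+
  qed
  have "free_ideal I B \<subseteq> ?T" unfolding free_ideal_def
  proof (rule formal_span_subset)
    show "{Poly_Mapping.single u 1 * r * Poly_Mapping.single v 1 |u r v.
        u \<in> words I B \<and> v \<in> words I B \<and> r \<in> free_relators I B} \<subseteq> ?T"
    proof clarify
      fix u v w :: "('a \<times> 'b) list" and r
      assume u: "u \<in> words I B" "v \<in> words I B" and r: "r \<in> free_relators I B"
        and w: "w \<in> Poly_Mapping.keys (Poly_Mapping.single u 1 * r * Poly_Mapping.single v (1::complex))"
      from w obtain w1 where w1: "w1 \<in> Poly_Mapping.keys (Poly_Mapping.single u 1 * r)" "w = w1 + v"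
        using keys_mult[of "Poly_Mapping.single u 1 * r" "Poly_Mapping.single v (1::complex)"] by auto
      from w1(1) obtain w2 where w2: "w2 \<in> Poly_Mapping.keys r" "w1 = u + w2"
        using keys_mult[of "Poly_Mapping.single u (1::complex)" r] by auto
      have "w2 \<in> words I B - {[]}" using rel[OF r] w2(1) by auto
      thus "w \<in> words I B - {[]}"
        using u w1(2) w2(2) by (auto intro!: append_in_words) (auto simp: plus_list_def)
    qed
  next
    fix f g :: "('a \<times> 'b) list \<Rightarrow>\<^sub>0 complex" assume "f \<in> ?T" "g \<in> ?T"
    thus "f + g \<in> ?T" using Poly_Mapping.keys_add[of f g] by blast
  next
    fix c and f :: "('a \<times> 'b) list \<Rightarrow>\<^sub>0 complex" assume "f \<in> ?T"
    thus "formal_smult c f \<in> ?T" using keys_formal_smult[of c f] by blast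
  qed simp
  thus ?thesis using assms(2) by blast
qed

lemma rep_free_product_keys:
  assumes "\<And>i. i \<in> I \<Longrightarrow> closed_under_operations (B i)" "X \<in> carrier (free_product I B)"
  shows "Poly_Mapping.keys (rep X) \<subseteq> words I B - {[]}"
proof -
  from assms(2) obtain f where f: "Poly_Mapping.keys f \<subseteq> words I B - {[]}"
    "X = residue_class (free_ideal I B) f"
    by (auto simp: free_product_def Let_def)
  have "rep X - f \<in> free_ideal I B" unfolding f(2)
    by (rule rep_residue_class) (simp add: free_ideal_def zero_in_formal_span)
  hence "Poly_Mapping.keys (rep X - f) \<subseteq> words I B - {[]}"
    using free_ideal_keys[of I B] assms(1) by blast
  thus ?thesis using f(1) Poly_Mapping.keys_add[of "rep X - f" f] by auto
qed

lemma free_product_closed_under_operations: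
  assumes "\<And>i. i \<in> I \<Longrightarrow> closed_under_operations (B i)"
  shows "closed_under_operations (free_product I B)"
proof -
  note k = rep_free_product_keys[of I B, OF assms]
  have carrier: "residue_class (free_ideal I B) f \<in> carrier (free_product I B)"
    if "Poly_Mapping.keys f \<subseteq> words I B - {[]}" for f
    using that by (auto simp: free_product_def Let_def)
  show ?thesis unfolding closed_under_operations_def
  proof (intro conjI ballI allI)
    fix X Y assume X: "X \<in> carrier (free_product I B)" and Y: "Y \<in> carrier (free_product I B)"
    show "X \<oplus>\<^bsub>free_product I B\<^esub> Y \<in> carrier (free_product I B)"
      using carrier[of "rep X + rep Y"] k[OF _ X] k[OF _ Y] Poly_Mapping.keys_add[of "rep X" "rep Y"]
      by (auto simp: free_product_def Let_def)
    have "Poly_Mapping.keys (rep X * rep Y) \<subseteq> words I B - {[]}"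
    proof
      fix w assume "w \<in> Poly_Mapping.keys (rep X * rep Y)"
      then obtain u v where "w = u + v" "u \<in> words I B - {[]}" "v \<in> words I B - {[]}"
        using keys_mult[of "rep X" "rep Y"] k[OF _ X] k[OF _ Y] by blast
      thus "w \<in> words I B - {[]}"
        by (auto intro!: append_in_words) (auto simp: plus_list_def)
    qed
    from carrier[OF this] show "X \<otimes>\<^bsub>free_product I B\<^esub> Y \<in> carrier (free_product I B)"
      by (auto simp: free_product_def Let_def)
  next
    fix c X assume X: "X \<in> carrier (free_product I B)"
    show "c \<odot>\<^bsub>free_product I B\<^esub> X \<in> carrier (free_product I B)"
      using carrier[of "formal_smult c (rep X)"] k[OF _ X] keys_formal_smult[of c "rep X"]
      by (auto simp: free_product_def Let_def)
  qed
qed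

lemma free_inclusion_in_carrier:
  assumes "i \<in> I" "x \<in> carrier (B i)"
  shows "free_inclusion I B i x \<in> carrier (free_product I B)"
  using assms unfolding free_inclusion_def free_product_def Let_def
  by (auto intro!: imageI simp: words_def)

section \<open>Tensor products\<close>

lemma sum_keys_superset:
  fixes F :: "'x \<Rightarrow> complex"
  assumes "finite S" "Poly_Mapping.keys f \<subseteq> S"
  shows "(\<Sum>u\<in>Poly_Mapping.keys f. Poly_Mapping.lookup f u * F u) = (\<Sum>u\<in>S. Poly_Mapping.lookup f u * F u)"
  by (rule sum.mono_neutral_left) (use assms in \<open>auto simp: in_keys_iff\<close>)

lemma sum_keys_add:
  fixes F :: "'x \<Rightarrow> complex"
  shows "(\<Sum>u\<in>Poly_Mapping.keys (f + g). Poly_Mapping.lookup (f + g) u * F u)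
     = (\<Sum>u\<in>Poly_Mapping.keys f. Poly_Mapping.lookup f u * F u) + (\<Sum>u\<in>Poly_Mapping.keys g. Poly_Mapping.lookup g u * F u)"
proof -
  let ?S = "Poly_Mapping.keys f \<union> Poly_Mapping.keys g"
  have "(\<Sum>u\<in>Poly_Mapping.keys (f + g). Poly_Mapping.lookup (f + g) u * F u)
      = (\<Sum>u\<in>?S. Poly_Mapping.lookup (f + g) u * F u)"
    by (rule sum_keys_superset) (auto simp: Poly_Mapping.keys_add)
  also have "\<dots> = (\<Sum>u\<in>?S. Poly_Mapping.lookup f u * F u) + (\<Sum>u\<in>?S. Poly_Mapping.lookup g u * F u)"
    by (simp add: lookup_add algebra_simps sum.distrib)
  finally show ?thesis
    by (simp only: sum_keys_superset[of ?S f] sum_keys_superset[of ?S g] Un_upper1 Un_upper2 finite_Un finite_keys simp_thms)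
qed

lemma sum_keys_smult:
  fixes F :: "'x \<Rightarrow> complex"
  shows "(\<Sum>u\<in>Poly_Mapping.keys (formal_smult c f). Poly_Mapping.lookup (formal_smult c f) u * F u)
     = c * (\<Sum>u\<in>Poly_Mapping.keys f. Poly_Mapping.lookup f u * F u)"
  using keys_formal_smult[of c f]
  by (subst sum_keys_superset[of "Poly_Mapping.keys f"]) (auto simp: sum_distrib_left mult.assoc)

lemma formal_inner_eq:
  "formal_inner I H f g = (\<Sum>v\<in>Poly_Mapping.keys g. Poly_Mapping.lookup g v *
     (\<Sum>u\<in>Poly_Mapping.keys f. cnj (Poly_Mapping.lookup f u) * (\<Prod>i\<in>I. inner (H i) (u i) (v i))))"
  unfolding formal_inner_def by (subst sum.swap) (simp add: sum_distrib_left mult_ac)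

lemma formal_inner_add_right: "formal_inner I H f (g + h) = formal_inner I H f g + formal_inner I H f h"
  unfolding formal_inner_eq by (rule sum_keys_add)

lemma formal_inner_smult_right: "formal_inner I H f (formal_smult c g) = c * formal_inner I H f g"
  unfolding formal_inner_eq by (rule sum_keys_smult)

lemma formal_inner_minus_right: "formal_inner I H f (g - h) = formal_inner I H f g - formal_inner I H f h"
  using formal_inner_add_right[of I H f "g - h" h] by simp

lemma formal_inner_single:
  "formal_inner I H f (Poly_Mapping.single v d) =
     d * (\<Sum>u\<in>Poly_Mapping.keys f. cnj (Poly_Mapping.lookup f u) * (\<Prod>i\<in>I. inner (H i) (u i) (v i)))"
  by (auto simp: formal_inner_eq)

lemma formal_inner_commute:
  assumes "\<And>i. i \<in> I \<Longrightarrow> prehilbert_space (H i)"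
    "Poly_Mapping.keys f \<subseteq> tensor_tuples I H" "Poly_Mapping.keys g \<subseteq> tensor_tuples I H"
  shows "formal_inner I H g f = cnj (formal_inner I H f g)"
proof -
  have "(\<Prod>i\<in>I. inner (H i) (v i) (u i)) = cnj (\<Prod>i\<in>I. inner (H i) (u i) (v i))"
    if "u \<in> Poly_Mapping.keys f" "v \<in> Poly_Mapping.keys g" for u v
  proof -
    have "u \<in> tensor_tuples I H" "v \<in> tensor_tuples I H" using that assms by auto
    thus ?thesis unfolding cnj_prod
      by (intro prod.cong refl prehilbert_space.inner_commute assms) (auto simp: tensor_tuples_def)
  qed
  thus ?thesis unfolding formal_inner_def
    by (subst sum.swap) (simp add: mult_ac)
qed

lemma prehilbert_closed:
  assumes "prehilbert_space H" "x \<in> carrier H" "y \<in> carrier H"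
  shows "x \<oplus>\<^bsub>H\<^esub> y \<in> carrier H" "c \<odot>\<^bsub>H\<^esub> x \<in> carrier H"
proof -
  interpret prehilbert_space H by fact
  show "x \<oplus>\<^bsub>H\<^esub> y \<in> carrier H" "c \<odot>\<^bsub>H\<^esub> x \<in> carrier H" using assms(2,3)
    by (auto intro: smult_closed[unfolded complex_field_def, simplified])
qed

lemma tensor_tuples_update:
  "v \<in> tensor_tuples I H \<Longrightarrow> i \<in> I \<Longrightarrow> x \<in> carrier (H i) \<Longrightarrow> v(i := x) \<in> tensor_tuples I H"
  unfolding tensor_tuples_def by (auto simp: PiE_iff extensional_def)

lemma tensor_relations_subset:
  assumes add: "\<And>v i x y. v \<in> tensor_tuples I H \<Longrightarrow> i \<in> I \<Longrightarrow> x \<in> carrier (H i) \<Longrightarrow> y \<in> carrier (H i) \<Longrightarrow>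
      Poly_Mapping.single (v(i := x \<oplus>\<^bsub>H i\<^esub> y)) 1
        - Poly_Mapping.single (v(i := x)) 1 - Poly_Mapping.single (v(i := y)) 1 \<in> T"
    and smult: "\<And>v i c x. v \<in> tensor_tuples I H \<Longrightarrow> i \<in> I \<Longrightarrow> x \<in> carrier (H i) \<Longrightarrow>
      Poly_Mapping.single (v(i := c \<odot>\<^bsub>H i\<^esub> x)) 1 - Poly_Mapping.single (v(i := x)) c \<in> T"
    and sub: "0 \<in> T" "\<And>f g. f \<in> T \<Longrightarrow> g \<in> T \<Longrightarrow> f + g \<in> T" "\<And>c f. f \<in> T \<Longrightarrow> formal_smult c f \<in> T"
  shows "tensor_relations I H \<subseteq> T"
  unfolding tensor_relations_def using add smult by (intro formal_span_subset sub) blast+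

lemma tensor_relations_keys:
  assumes "\<And>i. i \<in> I \<Longrightarrow> prehilbert_space (H i)" "f \<in> tensor_relations I H"
  shows "Poly_Mapping.keys f \<subseteq> tensor_tuples I H"
proof -
  let ?T = "{f :: ('a \<Rightarrow> 'b) \<Rightarrow>\<^sub>0 complex. Poly_Mapping.keys f \<subseteq> tensor_tuples I H}"
  have single: "Poly_Mapping.single w d \<in> ?T" if "w \<in> tensor_tuples I H" for w d
    using that by auto
  have diff: "f - g \<in> ?T" if "f \<in> ?T" "g \<in> ?T" for f g
    using that Poly_Mapping.keys_diff[of f g] by blast
  have "tensor_relations I H \<subseteq> ?T"
  proof (rule tensor_relations_subset)
    fix f g :: "('a \<Rightarrow> 'b) \<Rightarrow>\<^sub>0 complex" assume "f \<in> ?T" "g \<in> ?T"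
    thus "f + g \<in> ?T" using Poly_Mapping.keys_add[of f g] by blast
  next
    fix c and f :: "('a \<Rightarrow> 'b) \<Rightarrow>\<^sub>0 complex" assume "f \<in> ?T"
    thus "formal_smult c f \<in> ?T" using keys_formal_smult[of c f] by blast
  qed ((intro single diff tensor_tuples_update prehilbert_closed assms(1); assumption)+, simp)
  thus ?thesis using assms(2) by blast
qed

text \<open>
Multilinearity of \<open>(v\<^sub>i) \<mapsto> \<Prod>\<^sub>i \<langle>u\<^sub>i, v\<^sub>i\<rangle>\<close> says that the formal inner product kills the
relations of the tensor product in its second argument; by conjugate symmetry it then does so in
the first.  This is what makes the inner product of the tensor product computable.
\<close>

lemma formal_inner_tensor_relations:
  assumes "finite I" "\<And>i. i \<in> I \<Longrightarrow> prehilbert_space (H i)"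
    "Poly_Mapping.keys f \<subseteq> tensor_tuples I H" "g \<in> tensor_relations I H"
  shows "formal_inner I H f g = 0"
proof -
  have upd: "(\<Prod>k\<in>I. inner (H k) (u k) ((v(i := z)) k)) = inner (H i) (u i) z * (\<Prod>k\<in>I - {i}. inner (H k) (u k) (v k))"
    if "i \<in> I" for u v i z
    using that assms(1) by (subst prod.remove[of I i]) (auto intro!: arg_cong2[where f="(*)"] prod.cong)
  have u: "u i \<in> carrier (H i)" if "i \<in> I" "u \<in> Poly_Mapping.keys f" for i u
    using that assms(3) by (auto simp: tensor_tuples_def)
  have "tensor_relations I H \<subseteq> {g. formal_inner I H f g = 0}"
  proof (rule tensor_relations_subset; unfold mem_Collect_eq)
    fix v i x y assume i: "v \<in> tensor_tuples I H" "i \<in> I" "x \<in> carrier (H i)" "y \<in> carrier (H i)"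
    show "formal_inner I H f (Poly_Mapping.single (v(i := x \<oplus>\<^bsub>H i\<^esub> y)) 1
        - Poly_Mapping.single (v(i := x)) 1 - Poly_Mapping.single (v(i := y)) 1) = 0"
      unfolding formal_inner_minus_right formal_inner_single upd[OF i(2)]
      by (simp add: prehilbert_space.inner_add_right[OF assms(2)] u i ring_distribs sum.distrib)
  next
    fix v i c x assume i: "v \<in> tensor_tuples I H" "i \<in> I" "x \<in> carrier (H i)"
    show "formal_inner I H f (Poly_Mapping.single (v(i := c \<odot>\<^bsub>H i\<^esub> x)) 1 - Poly_Mapping.single (v(i := x)) c) = 0"
      unfolding formal_inner_minus_right formal_inner_single upd[OF i(2)]
      by (simp add: prehilbert_space.inner_smult_right[OF assms(2)] u i sum_distrib_left mult_ac)
  qed (auto simp: formal_inner_add_right formal_inner_smult_right, simp add: formal_inner_def)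
  thus ?thesis using assms(4) by blast
qed

text \<open>
The representatives selected by \<^term>\<open>rep\<close> differ from the defining formal tensors by relations,
which are removed first in the right and then, by conjugate symmetry, in the left argument.
\<close>

lemma inner_elementary_tensor:
  assumes "finite I" and pre: "\<And>i. i \<in> I \<Longrightarrow> prehilbert_space (H i)"
    and v: "\<And>i. i \<in> I \<Longrightarrow> v i \<in> carrier (H i)" and w: "\<And>i. i \<in> I \<Longrightarrow> w i \<in> carrier (H i)"
  shows "inner (tensor_product I H) (elementary_tensor I H v) (elementary_tensor I H w)
     = (\<Prod>i\<in>I. inner (H i) (v i) (w i))"
proof -
  let ?K = "tensor_relations I H"
  let ?s = "\<lambda>v. Poly_Mapping.single (restrict v I) (1::complex)"
  let ?r = "\<lambda>v. rep (elementary_tensor I H v)"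
  have s: "Poly_Mapping.keys (?s u) \<subseteq> tensor_tuples I H" if "\<And>i. i \<in> I \<Longrightarrow> u i \<in> carrier (H i)" for u
    using that by (auto simp: tensor_tuples_def)
  have r: "?r u - ?s u \<in> ?K" for u
    unfolding elementary_tensor_def
    by (rule rep_residue_class) (simp add: tensor_relations_def zero_in_formal_span)
  have k: "Poly_Mapping.keys (?r u) \<subseteq> tensor_tuples I H" if "\<And>i. i \<in> I \<Longrightarrow> u i \<in> carrier (H i)" for u
  proof -
    have "Poly_Mapping.keys (?r u - ?s u) \<subseteq> tensor_tuples I H"
      using tensor_relations_keys[of I H] pre r by blast
    thus ?thesis using s[OF that] Poly_Mapping.keys_add[of "?r u - ?s u" "?s u"] by auto
  qed
  have "formal_inner I H (?r v) (?r w - ?s w) = 0"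
    by (rule formal_inner_tensor_relations) (use assms k[of v] r in auto)
  hence 1: "formal_inner I H (?r v) (?r w) = formal_inner I H (?r v) (?s w)"
    by (simp add: formal_inner_minus_right)
  have "formal_inner I H (?s w) (?r v - ?s v) = 0"
    by (rule formal_inner_tensor_relations) (use assms s[of w] r in auto)
  hence "formal_inner I H (?s w) (?r v) = formal_inner I H (?s w) (?s v)"
    by (simp add: formal_inner_minus_right)
  moreover have "formal_inner I H (?r v) (?s w) = cnj (formal_inner I H (?s w) (?r v))"
    by (rule formal_inner_commute) (use pre k[of v] s[of w] v w in auto)
  moreover have "formal_inner I H (?s v) (?s w) = cnj (formal_inner I H (?s w) (?s v))"
    by (rule formal_inner_commute) (use pre s[of v] s[of w] v w in auto)
  ultimately have "formal_inner I H (?r v) (?s w) = formal_inner I H (?s v) (?s w)" by simp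
  with 1 show ?thesis
    by (simp add: tensor_product_def Let_def formal_inner_single cong: prod.cong)
qed

section \<open>Joint moments\<close>

text \<open>
A letter with face \<^term>\<open>p\<close> and index \<^term>\<open>k\<close> acts on the leg \<^term>\<open>i \<noteq> k\<close> either by the
vacuum projection or by the identity; this predicate singles out the first case.
\<close>

definition vacuum_hit :: "face \<Rightarrow> nat \<Rightarrow> nat \<Rightarrow> bool" where
  "vacuum_hit p k i \<longleftrightarrow> (case p of Left \<Rightarrow> i < k | Right \<Rightarrow> k < i)"

text \<open>
The vacuum expectation of what a word of indexed letters does on the leg \<^term>\<open>i\<close>, where
\<^term>\<open>\<mu>\<close> are the moments of one pair.  Reading from the left, \<^term>\<open>ps\<close> collects the letters with
index \<^term>\<open>i\<close> since the last vacuum projection; a projection closes the collected factor because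
\<open>\<langle>\<Omega>, X P Y \<Omega>\<rangle> = \<langle>\<Omega>, X \<Omega>\<rangle> \<langle>\<Omega>, Y \<Omega>\<rangle>\<close>.
\<close>

fun leg_moment :: "(face list \<Rightarrow> complex) \<Rightarrow> nat \<Rightarrow> face list \<Rightarrow> (face \<times> nat) list \<Rightarrow> complex" where
  "leg_moment \<mu> i ps [] = \<mu> ps"
| "leg_moment \<mu> i ps ((p, k) # us) =
     (if i = k then leg_moment \<mu> i (ps @ [p]) us
      else if vacuum_hit p k i then \<mu> ps * leg_moment \<mu> i [] us
      else leg_moment \<mu> i ps us)"

lemma linear_map_smult: "linear_map V W f \<Longrightarrow> x \<in> carrier V \<Longrightarrow> f (c \<odot>\<^bsub>V\<^esub> x) = c \<odot>\<^bsub>W\<^esub> f x"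
  by (simp add: linear_map_def)

lemma linear_map_closed: "linear_map V W f \<Longrightarrow> x \<in> carrier V \<Longrightarrow> f x \<in> carrier W"
  by (simp add: linear_map_def)

lemma inner_leg_operators:
  assumes H: "prehilbert_space H" and \<Omega>: "\<Omega> \<in> carrier H"
    and T: "\<And>p. linear_map H H (T p)"
    and \<mu>: "\<And>ps. inner H \<Omega> (foldr T ps \<Omega>) = \<mu> ps"
    and step: "\<And>p k. step (p, k) = (if i = k then T p else if vacuum_hit p k i then vacuum_projection H \<Omega> else id)"
  shows "foldr step us \<Omega> \<in> carrier H"
    and "inner H \<Omega> (foldr T ps (foldr step us \<Omega>)) = leg_moment \<mu> i ps us"
proof -
  have fc: "foldr T ps x \<in> carrier H" if "x \<in> carrier H" for ps x
    by (induction ps) (auto intro: linear_map_closed[OF T] that)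
  have fs: "foldr T ps (c \<odot>\<^bsub>H\<^esub> x) = c \<odot>\<^bsub>H\<^esub> foldr T ps x" if "x \<in> carrier H" for ps c x
    by (induction ps) (auto simp: linear_map_smult[OF T] that fc)
  show carrier: "foldr step us \<Omega> \<in> carrier H" for us
    by (induction us) (auto simp: step vacuum_projection_def \<Omega> intro!: linear_map_closed[OF T] prehilbert_closed H)
  show "inner H \<Omega> (foldr T ps (foldr step us \<Omega>)) = leg_moment \<mu> i ps us"
  proof (induction us arbitrary: ps)
    case Nil thus ?case by (simp add: \<mu>)
  next
    case (Cons a us)
    obtain p k where a: "a = (p, k)" by force
    consider "i = k" | "i \<noteq> k" "vacuum_hit p k i" | "i \<noteq> k" "\<not> vacuum_hit p k i" by blast
    thus ?case
    proof cases
      case 1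
      thus ?thesis using Cons[of "ps @ [p]"] by (simp add: a step)
    next
      case 2
      have "inner H \<Omega> (foldr T ps (foldr step (a # us) \<Omega>))
          = inner H \<Omega> (foldr T ps (inner H \<Omega> (foldr step us \<Omega>) \<odot>\<^bsub>H\<^esub> \<Omega>))"
        using 2 by (simp add: a step vacuum_projection_def)
      also have "\<dots> = leg_moment \<mu> i [] us * \<mu> ps"
        using Cons[of "[]"] by (simp add: fs \<Omega> prehilbert_space.inner_smult_right[OF H] fc \<mu>)
      finally show ?thesis using 2 by (simp add: a)
    next
      case 3
      thus ?thesis using Cons[of ps] by (simp add: a step)
    qed
  qed
qed

lemma algebra_hom_mult:
  "algebra_hom B C f \<Longrightarrow> x \<in> carrier B \<Longrightarrow> y \<in> carrier B \<Longrightarrow> f (x \<otimes>\<^bsub>B\<^esub> y) = f x \<otimes>\<^bsub>C\<^esub> f y"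
  by (simp add: algebra_hom_def)

lemma algebra_hom_closed: "algebra_hom B C f \<Longrightarrow> x \<in> carrier B \<Longrightarrow> f x \<in> carrier C"
  by (simp add: algebra_hom_def linear_map_def)

lemma unital_extension_embed:
  assumes "unital_star_algebra A" "j x \<in> carrier A"
  shows "unital_extension A j (0, x) = j x"
proof -
  interpret unital_star_algebra A by fact
  have "0 \<odot>\<^bsub>A\<^esub> \<one>\<^bsub>A\<^esub> = \<zero>\<^bsub>A\<^esub>"
    using smult_l_null[of "\<one>\<^bsub>A\<^esub>"] by (simp add: complex_field_def)
  thus ?thesis using assms(2) by (simp add: unital_extension_def)
qed

lemma list_product_closed:
  assumes "unital_star_algebra A" "set xs \<subseteq> carrier A"
  shows "list_product A xs \<in> carrier A"
proof -
  interpret unital_star_algebra A by fact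
  show ?thesis using assms(2)
    by (induction xs) (auto simp: list_product_def intro: mult_closed)
qed

text \<open>
The product of the letters in the two-faced algebra is sent by both homomorphisms, the one into the
ambient algebra and the representation, to the product of the images.  The word has to be nonempty
because the free product has no unit.
\<close>

lemma two_faced_word:
  assumes A: "unital_star_algebra A"
    and b: "\<And>p. b p \<in> carrier (B p)"
    and F: "closed_under_operations (two_faced_algebra B)"
    and j: "algebra_hom (two_faced_algebra B) A j" "\<And>p. j (free_inclusion UNIV B p (b p)) = a p"
    and \<pi>: "representation (two_faced_algebra B) H \<pi>"
    and ps: "ps \<noteq> []"
  shows "\<exists>X\<in>carrier (two_faced_algebra B). j X = list_product A (map a ps) \<and>
    (\<forall>v\<in>carrier H. \<pi> X v = foldr (\<lambda>p. \<pi> (free_inclusion UNIV B p (b p))) ps v)"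
proof -
  interpret unital_star_algebra A by fact
  let ?F = "two_faced_algebra B"
  let ?x = "\<lambda>p. free_inclusion UNIV B p (b p)"
  have x: "?x p \<in> carrier ?F" for p by (rule free_inclusion_in_carrier) (auto simp: b)
  show ?thesis using ps
  proof (induction ps rule: list_nonempty_induct)
    case (single p)
    have "j (?x p) \<in> carrier A" using algebra_hom_closed[OF j(1) x] .
    thus ?case using x[of p] j(2)[of p] by (intro bexI[of _ "?x p"]) (auto simp: list_product_def)
  next
    case (cons p ps)
    then obtain X where X: "X \<in> carrier ?F" "j X = list_product A (map a ps)"
      "\<And>v. v \<in> carrier H \<Longrightarrow> \<pi> X v = foldr (\<lambda>p. \<pi> (?x p)) ps v" by blast
    show ?case
    proof (intro bexI[of _ "?x p \<otimes>\<^bsub>?F\<^esub> X"] conjI ballI)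
      show "?x p \<otimes>\<^bsub>?F\<^esub> X \<in> carrier ?F" using F x X(1) by (auto simp: closed_under_operations_def)
      show "j (?x p \<otimes>\<^bsub>?F\<^esub> X) = list_product A (map a (p # ps))"
        using algebra_hom_mult[OF j(1) x X(1)] j(2) X(2) by (simp add: list_product_def)
      show "\<pi> (?x p \<otimes>\<^bsub>?F\<^esub> X) v = foldr (\<lambda>p. \<pi> (?x p)) (p # ps) v" if "v \<in> carrier H" for v
        using \<pi> x X(1) that X(3)[OF that] by (simp add: representation_def)
    qed
  qed
qed

text \<open>
A tensor operator is specified on extensional tuples only; an elementary tensor restricts its
argument to the index set, so the formula extends to arbitrary families.
\<close>

lemma is_tensor_operator_apply:
  assumes "is_tensor_operator I H T S" "\<And>i. i \<in> I \<Longrightarrow> w i \<in> carrier (H i)"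
  shows "S (elementary_tensor I H w) = elementary_tensor I H (\<lambda>i. T i (w i))"
proof -
  have "elementary_tensor I H u = elementary_tensor I H (restrict u I)" for u
    by (simp add: elementary_tensor_def)
  moreover have "S (elementary_tensor I H (restrict w I)) = elementary_tensor I H (\<lambda>i. T i (restrict w I i))"
    using assms by (auto simp: is_tensor_operator_def tensor_tuples_def)
  moreover have "elementary_tensor I H (\<lambda>i. T i (restrict w I i)) = elementary_tensor I H (\<lambda>i. T i (w i))"
    by (simp add: elementary_tensor_def restrict_def cong: if_cong)
  ultimately show ?thesis by simp
qed

lemma elementary_tensor_in_carrier:
  "(\<And>i. i \<in> I \<Longrightarrow> w i \<in> carrier (H i)) \<Longrightarrow> elementary_tensor I H w \<in> carrier (tensor_product I H)"
  unfolding elementary_tensor_def tensor_product_def Let_def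
  by (auto intro!: imageI simp: tensor_tuples_def)

text \<open>
This turns independence into combinatorics.  The operators \<open>P \<otimes> \<dots> \<otimes> \<pi>(b) \<otimes> \<dots> \<otimes> id\<close> map
elementary tensors to elementary tensors, so the vacuum vector stays elementary along the word and
its final inner product with the vacuum is the product over the legs.
\<close>

lemma joint_moment_factorizes:
  assumes prob: "nc_probability_space A \<Phi>"
    and indep: "bimonotone_independent_pairs A \<Phi> N b"
    and b: "\<And>k p. k \<in> {1..N} \<Longrightarrow> b k p \<in> carrier A"
    and us: "snd ` set us \<subseteq> {1..N}"
  shows "\<Phi> (list_product A (map (\<lambda>(p, k). b k p) us))
     = (\<Prod>i\<in>{1..N}. leg_moment (pair_distribution A \<Phi> (b i)) i [] us)"
proof (cases "us = []")
  case True
  have "\<Phi> \<one>\<^bsub>A\<^esub> = 1" using prob by (simp add: nc_probability_space_def state_def)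
  thus ?thesis by (simp add: True list_product_def pair_distribution_def)
next
  case False
  have A: "unital_star_algebra A" using prob by (simp add: nc_probability_space_def)
  interpret unital_star_algebra A by fact
  let ?B = "\<lambda>k. pair_faces A (b k)"
  let ?F = "\<lambda>k. two_faced_algebra (?B k)"
  let ?G = "free_product {1..N} ?F"
  let ?x = "\<lambda>k p. free_inclusion UNIV (?B k) p (b k p)"
  let ?X = "\<lambda>k p. free_inclusion {1..N} ?F k (?x k p)"
  obtain j where lift: "\<And>k. k \<in> {1..N} \<Longrightarrow> is_free_lift UNIV (?B k) A (\<lambda>p a. a) (j k)"
    and ind: "bimonotone_independent A \<Phi> N ?B j"
    using indep unfolding bimonotone_independent_pairs_def by blast
  obtain J where rv: "\<And>k. k \<in> {1..N} \<Longrightarrow> two_faced_random_variable A (?B k) (j k)"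
    and J: "is_free_lift {1..N} ?F A j J"
    and bp: "is_bimonotone_product N ?B (\<lambda>k. \<Phi> \<circ> unital_extension A (j k)) (\<Phi> \<circ> unital_extension A J)"
    using ind unfolding bimonotone_independent_def by blast
  obtain H :: "nat \<Rightarrow> (complex \<times> 'a two_faced_elem) set prehilbert" and \<Omega> \<pi> \<rho> where
    psr: "\<And>k. k \<in> {1..N} \<Longrightarrow> pointed_star_representation (?F k) (H k) (\<Omega> k) (\<pi> k)"
    and \<phi>: "\<And>k x. k \<in> {1..N} \<Longrightarrow> x \<in> carrier (?F k) \<Longrightarrow>
        (\<Phi> \<circ> unital_extension A (j k)) (0, x) = inner (H k) (\<Omega> k) (\<pi> k x (\<Omega> k))"
    and bm: "is_bimonotone_representation N ?B H \<Omega> \<pi> \<rho>"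
    and \<psi>: "\<And>c x. x \<in> carrier ?G \<Longrightarrow> (\<Phi> \<circ> unital_extension A J) (c, x) =
        c + inner (tensor_product {1..N} H) (elementary_tensor {1..N} H \<Omega>) (\<rho> x (elementary_tensor {1..N} H \<Omega>))"
    using bp unfolding is_bimonotone_product_def Let_def by blast
  have b_face: "b k p \<in> carrier (?B k p)" for k p
    by (simp add: pair_faces_def star_generated.generator)
  have x: "?x k p \<in> carrier (?F k)" for k p
    by (rule free_inclusion_in_carrier) (auto simp: b_face)
  have X: "?X k p \<in> carrier ?G" if "k \<in> {1..N}" for k p
    by (rule free_inclusion_in_carrier[where B = ?F, OF that x])
  have F: "closed_under_operations (?F k)" if "k \<in> {1..N}" for k
    using rv[OF that] unfolding two_faced_random_variable_def
    by (intro free_product_closed_under_operations star_algebra_closed_under_operations) blast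
  have G: "closed_under_operations ?G" by (rule free_product_closed_under_operations) (rule F)
  have jhom: "algebra_hom (?F k) A (j k)" and jx: "j k (?x k p) = b k p" if "k \<in> {1..N}" for k p
    using lift[OF that] b_face unfolding is_free_lift_def by auto
  have Jhom: "algebra_hom ?G A J" and JX: "\<And>k p. k \<in> {1..N} \<Longrightarrow> J (?X k p) = b k p"
    using J x jx unfolding is_free_lift_def by auto
  have H: "prehilbert_space (H k)" and \<Omega>: "\<Omega> k \<in> carrier (H k)" "inner (H k) (\<Omega> k) (\<Omega> k) = 1"
    and \<pi>: "representation (?F k) (H k) (\<pi> k)" if "k \<in> {1..N}" for k
    using psr[OF that] by (auto simp: pointed_star_representation_def)
  have T: "linear_map (H k) (H k) (\<pi> k (?x k p))" if "k \<in> {1..N}" for k p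
    using \<pi>[OF that] x by (auto simp: representation_def)
  \<comment> \<open>On a single leg the defining property of the representation gives back the moments of the pair.\<close>
  have face_moment: "inner (H k) (\<Omega> k) (foldr (\<lambda>p. \<pi> k (?x k p)) ps (\<Omega> k)) = pair_distribution A \<Phi> (b k) ps"
    if k: "k \<in> {1..N}" for k ps
  proof (cases "ps = []")
    case True
    have "\<Phi> \<one>\<^bsub>A\<^esub> = 1" using prob by (simp add: nc_probability_space_def state_def)
    thus ?thesis by (simp add: True \<Omega>[OF k] pair_distribution_def list_product_def)
  next
    case False
    from two_faced_word[of A "b k" "?B k" "j k" "b k", OF A b_face F[OF k] jhom[OF k] jx[OF k] \<pi>[OF k] False]
    obtain Y where Y: "Y \<in> carrier (?F k)" "j k Y = list_product A (map (b k) ps)"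
      "\<And>v. v \<in> carrier (H k) \<Longrightarrow> \<pi> k Y v = foldr (\<lambda>p. \<pi> k (?x k p)) ps v" by blast
    have "unital_extension A (j k) (0, Y) = j k Y"
      by (rule unital_extension_embed[OF A]) (rule algebra_hom_closed[OF jhom[OF k] Y(1)])
    thus ?thesis using \<phi>[OF k Y(1)] Y(2) Y(3)[OF \<Omega>(1)[OF k]] by (simp add: pair_distribution_def)
  qed
  define step where "step i = (\<lambda>(p, k). bimonotone_leg H \<Omega> p k (\<pi> k (?x k p)) i)" for i
  have step: "step i (p, k) = (if i = k then \<pi> i (?x i p) else if vacuum_hit p k i then vacuum_projection (H i) (\<Omega> i) else id)"
    for i p k by (auto simp: step_def bimonotone_leg_def vacuum_hit_def)
  note leg = inner_leg_operators[OF H \<Omega>(1) T face_moment step]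
  have \<rho>: "representation ?G (tensor_product {1..N} H) \<rho>"
    and \<rho>X: "\<And>k p. k \<in> {1..N} \<Longrightarrow> is_tensor_operator {1..N} H (\<lambda>i. step i (p, k)) (\<rho> (?X k p))"
    using bm b_face by (auto simp: is_bimonotone_representation_def Let_def step_def eta_contract_eq)
  let ?vac = "elementary_tensor {1..N} H \<Omega>"
  have vac: "?vac \<in> carrier (tensor_product {1..N} H)"
    by (rule elementary_tensor_in_carrier) (rule \<Omega>)
  have "\<exists>Y\<in>carrier ?G. J Y = list_product A (map (\<lambda>(p, k). b k p) us) \<and>
      \<rho> Y ?vac = elementary_tensor {1..N} H (\<lambda>i. foldr (step i) us (\<Omega> i))"
    using False us
  proof (induction us rule: list_nonempty_induct)
    case (single u)
    obtain p k where u: "u = (p, k)" by force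
    with single have k: "k \<in> {1..N}" by auto
    show ?case
      using X[OF k] JX[OF k, of p] b[OF k, of p] is_tensor_operator_apply[OF \<rho>X[OF k], of \<Omega> p] \<Omega>(1)
      by (intro bexI[of _ "?X k p"]) (auto simp: u list_product_def)
  next
    case (cons u us)
    obtain p k where u: "u = (p, k)" by force
    with cons have k: "k \<in> {1..N}" by auto
    from cons obtain Y where Y: "Y \<in> carrier ?G" "J Y = list_product A (map (\<lambda>(p, k). b k p) us)"
      "\<rho> Y ?vac = elementary_tensor {1..N} H (\<lambda>i. foldr (step i) us (\<Omega> i))" by auto
    have "\<rho> (?X k p \<otimes>\<^bsub>?G\<^esub> Y) ?vac = \<rho> (?X k p) (\<rho> Y ?vac)"
      using \<rho> X[OF k] Y(1) vac unfolding representation_def by blast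
    also have "\<dots> = elementary_tensor {1..N} H (\<lambda>i. foldr (step i) (u # us) (\<Omega> i))"
      using is_tensor_operator_apply[OF \<rho>X[OF k], of "\<lambda>i. foldr (step i) us (\<Omega> i)" p] leg(1)
      unfolding Y(3) by (simp add: u)
    finally have "\<rho> (?X k p \<otimes>\<^bsub>?G\<^esub> Y) ?vac = elementary_tensor {1..N} H (\<lambda>i. foldr (step i) (u # us) (\<Omega> i))" .
    moreover have "?X k p \<otimes>\<^bsub>?G\<^esub> Y \<in> carrier ?G"
      using G X[OF k] Y(1) unfolding closed_under_operations_def by blast
    moreover have "J (?X k p \<otimes>\<^bsub>?G\<^esub> Y) = list_product A (map (\<lambda>(p, k). b k p) (u # us))"
      using algebra_hom_mult[OF Jhom X[OF k] Y(1)] JX[OF k] Y(2) by (simp add: u list_product_def)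
    ultimately show ?case by blast
  qed
  then obtain Y where Y: "Y \<in> carrier ?G" "J Y = list_product A (map (\<lambda>(p, k). b k p) us)"
      "\<rho> Y ?vac = elementary_tensor {1..N} H (\<lambda>i. foldr (step i) us (\<Omega> i))" by blast
  have "unital_extension A J (0, Y) = J Y"
    by (rule unital_extension_embed[OF A]) (rule algebra_hom_closed[OF Jhom Y(1)])
  hence "\<Phi> (J Y) = inner (tensor_product {1..N} H) ?vac (\<rho> Y ?vac)"
    using \<psi>[OF Y(1), of 0] by simp
  also have "\<dots> = (\<Prod>i\<in>{1..N}. inner (H i) (\<Omega> i) (foldr (step i) us (\<Omega> i)))"
    unfolding Y(3) by (rule inner_elementary_tensor) (auto intro: H \<Omega> leg(1))
  also have "\<dots> = (\<Prod>i\<in>{1..N}. leg_moment (pair_distribution A \<Phi> (b i)) i [] us)"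
    using leg(2)[where ps = "[]"] by (intro prod.cong refl) simp
  finally show ?thesis using Y(2) by simp
qed

section \<open>Counting index functions by ordered partitions\<close>

definition fiber :: "'x set \<Rightarrow> ('x \<Rightarrow> nat) \<Rightarrow> nat \<Rightarrow> 'x set" where
  "fiber X k i = {t \<in> X. k t = i}"

text \<open>
The ordered partition induced by an index function: its blocks are the level sets, and the block
order reverses the order of the indices.  The reversal matches the bi-monotone condition, since a
left letter with index \<open>l\<close> projects the legs \<open>i < l\<close> and therefore wants the blocks of the
surrounding pairs to have larger indices, that is, to be smaller blocks.
\<close>

definition index_type :: "'x set \<Rightarrow> ('x \<Rightarrow> nat) \<Rightarrow> 'x set set \<times> ('x set \<times> 'x set) set" where
  "index_type X k = (fiber X k ` k ` X,
     {(fiber X k i, fiber X k j) | i j. i \<in> k ` X \<and> j \<in> k ` X \<and> j \<le> i})"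

definition ordered_pair_partitions :: "'x set \<Rightarrow> ('x set set \<times> ('x set \<times> 'x set) set) set" where
  "ordered_pair_partitions X = {(P, r). ordered_partition X P r \<and> (\<forall>V\<in>P. card V = 2)}"

definition rank_in :: "'y set \<Rightarrow> ('y \<times> 'y) set \<Rightarrow> 'y \<Rightarrow> nat" where
  "rank_in Y r x = card {y \<in> Y. (x, y) \<in> r}"

lemma rank_in_le_iff:
  assumes "finite Y" "linear_order_on Y r" "x \<in> Y" "y \<in> Y"
  shows "(x, y) \<in> r \<longleftrightarrow> rank_in Y r y \<le> rank_in Y r x"
proof -
  have r: "refl_on Y r" "trans r" "antisym r" "total_on Y r"
    using assms(2) by (auto simp: order_on_defs)
  show ?thesis
  proof
    assume "(x, y) \<in> r"
    hence "{z \<in> Y. (y, z) \<in> r} \<subseteq> {z \<in> Y. (x, z) \<in> r}" using r(2) by (auto dest: transD)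
    thus "rank_in Y r y \<le> rank_in Y r x" unfolding rank_in_def using assms(1) by (intro card_mono) auto
  next
    assume le: "rank_in Y r y \<le> rank_in Y r x"
    show "(x, y) \<in> r"
    proof (rule ccontr)
      assume n: "(x, y) \<notin> r"
      have yy: "(y, y) \<in> r" using r(1) assms(4) by (auto simp: refl_on_def)
      have yx: "(y, x) \<in> r" using r(4) n assms(3,4) yy by (auto simp: total_on_def)
      have "{z \<in> Y. (x, z) \<in> r} \<subset> {z \<in> Y. (y, z) \<in> r}"
        using n yy yx r(2) assms(4) by (auto dest: transD)
      hence "rank_in Y r x < rank_in Y r y" unfolding rank_in_def using assms(1) by (intro psubset_card_mono) auto
      with le show False by simp
    qed
  qed
qed

text \<open>
Ranks identify any finite linear order with an initial segment of the natural numbers, so two finite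
linear orders of the same size can be compared through them.
\<close>

lemma rank_in_bij_betw:
  assumes "finite Y" "linear_order_on Y r"
  shows "bij_betw (rank_in Y r) Y {1..card Y}"
proof -
  have r: "refl_on Y r" "antisym r" using assms(2) by (auto simp: order_on_defs)
  have inj: "inj_on (rank_in Y r) Y"
    by (rule inj_onI, rule antisymD[OF r(2)]) (simp_all add: rank_in_le_iff[OF assms])
  have "rank_in Y r ` Y \<subseteq> {1..card Y}"
  proof clarify
    fix x assume "x \<in> Y"
    hence "x \<in> {y \<in> Y. (x, y) \<in> r}" using r(1) by (auto simp: refl_on_def)
    hence "card {y \<in> Y. (x, y) \<in> r} \<noteq> 0" using assms(1) by auto
    moreover have "card {y \<in> Y. (x, y) \<in> r} \<le> card Y" using assms(1) by (intro card_mono) auto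
    ultimately show "rank_in Y r x \<in> {1..card Y}" by (simp add: rank_in_def)
  qed
  moreover have "card (rank_in Y r ` Y) = card {1..card Y}" using inj by (simp add: card_image)
  ultimately show ?thesis using inj by (auto simp: bij_betw_def card_subset_eq)
qed

lemma linear_order_on_ge: "linear_order_on S {(x, y). x \<in> S \<and> y \<in> S \<and> y \<le> (x::nat)}"
  by (auto simp: order_on_defs refl_on_def trans_def antisym_def total_on_def)

text \<open>
Equate the ranks on both sides.  The set of numbers is ordered by \<open>\<ge>\<close>, whence the reversal.
\<close>

lemma order_isomorphism_to_nat_set:
  fixes S :: "nat set"
  assumes Y: "finite Y" "linear_order_on Y r" and S: "finite S" "card S = card Y"
  obtains h where "bij_betw h Y S" "\<And>x y. x \<in> Y \<Longrightarrow> y \<in> Y \<Longrightarrow> (x, y) \<in> r \<longleftrightarrow> h y \<le> h x"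
proof -
  let ?s = "{(x, y). x \<in> S \<and> y \<in> S \<and> y \<le> x}"
  note f = rank_in_bij_betw[OF S(1) linear_order_on_ge]
  note g = rank_in_bij_betw[OF Y]
  define h where "h = inv_into S (rank_in S ?s) \<circ> rank_in Y r"
  have h: "bij_betw h Y S" unfolding h_def
    by (rule bij_betw_trans[OF g]) (use bij_betw_inv_into[OF f] S(2) in simp)
  have fh: "rank_in S ?s (h x) = rank_in Y r x" if "x \<in> Y" for x
    unfolding h_def using f g that S(2) by (auto simp: bij_betw_def intro!: f_inv_into_f)
  have "(x, y) \<in> r \<longleftrightarrow> h y \<le> h x" if "x \<in> Y" "y \<in> Y" for x y
  proof -
    have hS: "h x \<in> S" "h y \<in> S" using h that by (auto simp: bij_betw_def)
    have "(x, y) \<in> r \<longleftrightarrow> (h x, h y) \<in> ?s"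
      using rank_in_le_iff[OF Y that] rank_in_le_iff[OF S(1) linear_order_on_ge hS] by (simp add: fh that)
    thus ?thesis using hS by simp
  qed
  with h show ?thesis by (rule that)
qed

lemma fiber_inj: "inj_on (fiber X k) (k ` X)"
  by (auto simp: inj_on_def fiber_def)

lemma index_type_order_iff:
  assumes "i \<in> k ` X" "j \<in> k ` X"
  shows "(fiber X k i, fiber X k j) \<in> snd (index_type X k) \<longleftrightarrow> j \<le> i"
  using assms fiber_inj[of X k] by (auto simp: index_type_def inj_on_eq_iff)

lemma index_type_in_ordered_pair_partitions:
  assumes "\<And>i. i \<in> k ` X \<Longrightarrow> card (fiber X k i) = 2"
  shows "index_type X k \<in> ordered_pair_partitions X"
proof -
  have "partition_on X (fiber X k ` k ` X)"
    by (rule partition_onI) (auto simp: fiber_def disjnt_def)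
  moreover have "linear_order_on (fiber X k ` k ` X) (snd (index_type X k))"
    unfolding order_on_defs
  proof (intro conjI)
    show "snd (index_type X k) \<subseteq> fiber X k ` k ` X \<times> fiber X k ` k ` X"
      by (auto simp: index_type_def)
    note sub = this
    have blocks: "\<exists>a\<in>k ` X. \<exists>b\<in>k ` X. U = fiber X k a \<and> V = fiber X k b"
      if "(U, V) \<in> snd (index_type X k)" for U V
      using sub that by blast
    show "trans (snd (index_type X k))"
    proof (rule transI)
      fix U V W assume UV: "(U, V) \<in> snd (index_type X k)" and VW: "(V, W) \<in> snd (index_type X k)"
      obtain a b where ab: "U = fiber X k a" "V = fiber X k b" "a \<in> k ` X" "b \<in> k ` X"
        using blocks[OF UV] by blast
      obtain c where c: "W = fiber X k c" "c \<in> k ` X" using blocks[OF VW] by blast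
      have "b \<le> a" "c \<le> b"
        using UV VW index_type_order_iff[OF ab(3,4)] index_type_order_iff[OF ab(4) c(2)] ab c by auto
      thus "(U, W) \<in> snd (index_type X k)" unfolding ab c index_type_order_iff[OF ab(3) c(2)] by simp
    qed
    show "antisym (snd (index_type X k))"
    proof (rule antisymI)
      fix U V assume UV: "(U, V) \<in> snd (index_type X k)" and VU: "(V, U) \<in> snd (index_type X k)"
      obtain a b where ab: "U = fiber X k a" "V = fiber X k b" "a \<in> k ` X" "b \<in> k ` X"
        using blocks[OF UV] by blast
      have "b \<le> a" "a \<le> b"
        using UV VU index_type_order_iff[OF ab(3,4)] index_type_order_iff[OF ab(4,3)] ab by auto
      thus "U = V" unfolding ab by simp
    qed
    show "refl_on (fiber X k ` k ` X) (snd (index_type X k))"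
      "total_on (fiber X k ` k ` X) (snd (index_type X k))"
      by (auto simp: refl_on_def total_on_def index_type_order_iff)
  qed
  ultimately show ?thesis
    using assms by (auto simp: ordered_pair_partitions_def ordered_partition_def index_type_def)
qed

lemma finite_ordered_pair_partitions:
  assumes "finite X" shows "finite (ordered_pair_partitions X)"
proof (rule finite_subset)
  show "ordered_pair_partitions X \<subseteq> Pow (Pow X) \<times> Pow (Pow X \<times> Pow X)"
    by (fastforce simp: ordered_pair_partitions_def ordered_partition_def order_on_defs partition_on_def)
qed (use assms in simp)

lemma card_pair_partition:
  assumes "finite X" "(P, r) \<in> ordered_pair_partitions X" "card X = 2 * n"
  shows "card P = n" "finite P"
proof -
  have P: "partition_on X P" "\<And>V. V \<in> P \<Longrightarrow> card V = 2"
    using assms(2) by (auto simp: ordered_pair_partitions_def ordered_partition_def)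
  show "finite P" using finite_elements[OF assms(1) P(1)] .
  have "card X = (\<Sum>V\<in>P. card V)" using product_partition[OF P(1)] assms(1) P(1)
    by (metis finite_subset partition_on_def Union_upper)
  with P(2) assms(3) show "card P = n" by simp
qed

text \<open>
An index function of a given type is determined by its image, since it is an order-reversing
bijection from the \<open>n\<close> blocks to the image; conversely each \<open>n\<close>-element subset of \<open>{1..N}\<close> is such an
image.
\<close>

lemma card_index_functions_of_type:
  assumes X: "finite X" "card X = 2 * n" and \<tau>: "\<tau> \<in> ordered_pair_partitions X"
  shows "card {k \<in> X \<rightarrow>\<^sub>E {1..N}. index_type X k = \<tau>} = N choose n"
proof -
  obtain P r where Pr: "\<tau> = (P, r)" by force
  have P: "partition_on X P" "linear_order_on P r" "\<And>V. V \<in> P \<Longrightarrow> card V = 2"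
    using \<tau> by (auto simp: Pr ordered_pair_partitions_def ordered_partition_def)
  have cP: "card P = n" "finite P" using card_pair_partition[OF X(1) _ X(2)] \<tau> Pr by auto
  let ?K = "{k \<in> X \<rightarrow>\<^sub>E {1..N}. index_type X k = \<tau>}"
  let ?S = "{S. S \<subseteq> {1..N} \<and> card S = n}"
  have "bij_betw (\<lambda>k. k ` X) ?K ?S"
  proof (rule bij_betw_imageI)
    show "inj_on (\<lambda>k. k ` X) ?K"
    proof (rule inj_onI; clarify)
      fix k k' assume k: "k \<in> X \<rightarrow>\<^sub>E {1..N}" "k' \<in> X \<rightarrow>\<^sub>E {1..N}" and \<tau>k: "index_type X k' = index_type X k"
        and img: "k ` X = k' ` X"
      let ?le = "\<lambda>m. {j \<in> k ` X. j \<le> m}"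
      \<comment> \<open>The rank of the block of a point in the type is the rank of its value in the image, so type and image determine the value.\<close>
      have rank: "card {W \<in> fiber X f ` f ` X. (fiber X f i, W) \<in> snd (index_type X f)} = card {j \<in> f ` X. j \<le> i}"
        if "i \<in> f ` X" for f :: "'a \<Rightarrow> nat" and i
      proof -
        have "{W \<in> fiber X f ` f ` X. (fiber X f i, W) \<in> snd (index_type X f)} = fiber X f ` {j \<in> f ` X. j \<le> i}"
          using index_type_order_iff[OF that] by auto
        thus ?thesis using fiber_inj[of X f] by (auto intro!: card_image elim: inj_on_subset)
      qed
      show "k = k'"
      proof
        fix t show "k t = k' t"
        proof (cases "t \<in> X")
          case True
          have fs: "fiber X k ` k ` X = fiber X k' ` k' ` X" using \<tau>k by (simp add: index_type_def)
          have "fiber X k (k t) \<in> fiber X k' ` k' ` X" using fs True by blast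
          then obtain j where "fiber X k (k t) = fiber X k' j" by blast
          moreover have "t \<in> fiber X k (k t)" using True by (simp add: fiber_def)
          ultimately have f: "fiber X k (k t) = fiber X k' (k' t)" by (auto simp: fiber_def)
          have "card (?le (k t)) = card {W \<in> fiber X k ` k ` X. (fiber X k (k t), W) \<in> snd (index_type X k)}"
            using rank[of "k t" k] True by simp
          also have "\<dots> = card {W \<in> fiber X k' ` k' ` X. (fiber X k' (k' t), W) \<in> snd (index_type X k')}"
            by (simp only: fs f \<tau>k)
          also have "\<dots> = card (?le (k' t))" using rank[of "k' t" k'] True img by simp
          finally have eq: "card (?le (k t)) = card (?le (k' t))" .
          have less: "card (?le a) < card (?le b)" if "a < b" "b \<in> k ` X" for a b
          proof (rule psubset_card_mono)
            have "b \<in> ?le b" "b \<notin> ?le a" using that by auto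
            moreover have "?le a \<subseteq> ?le b" using that by auto
            ultimately show "?le a \<subset> ?le b" by blast
          qed (use X(1) in simp)
          have "k t \<in> k ` X" "k' t \<in> k ` X" using True img by auto
          thus ?thesis using less[of "k t" "k' t"] less[of "k' t" "k t"] eq
            by (cases "k t" "k' t" rule: linorder_cases) simp_all
        qed (use k in \<open>auto simp: PiE_iff extensional_def\<close>)
      qed
    qed
    have "k ` X \<in> ?S" if "k \<in> ?K" for k
    proof -
      have "card (k ` X) = card P" using that fiber_inj[of X k] by (auto simp: Pr index_type_def card_image)
      thus ?thesis using that cP(1) by auto
    qed
    moreover have "S \<in> (\<lambda>k. k ` X) ` ?K" if S: "S \<in> ?S" for S
    proof -
      have "finite S" "card S = card P" using S cP(1) by (auto intro: finite_subset)
      from order_isomorphism_to_nat_set[OF cP(2) P(2) this]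
      obtain h where h: "bij_betw h P S" "\<And>V W. V \<in> P \<Longrightarrow> W \<in> P \<Longrightarrow> (V, W) \<in> r \<longleftrightarrow> h W \<le> h V" by blast
      define k where "k = (\<lambda>t\<in>X. h (THE V. V \<in> P \<and> t \<in> V))"
      have k: "k t = h V" if "V \<in> P" "t \<in> V" for V t
      proof -
        have "t \<in> X" using that P(1) by (auto simp: partition_on_def)
        moreover have "(THE V. V \<in> P \<and> t \<in> V) = V"
          using that P(1) by (intro the_equality) (auto simp: partition_on_def disjoint_def)
        ultimately show ?thesis by (simp add: k_def)
      qed
      have XP: "X = \<Union>P" and ne: "{} \<notin> P" using P(1) by (auto simp: partition_on_def)
      have img: "k ` X = S"
      proof -
        have "k ` X = h ` P" using XP ne k by (auto simp: image_iff) (metis ex_in_conv)+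
        thus ?thesis using h(1) by (simp add: bij_betw_def)
      qed
      have fib: "fiber X k (h V) = V" if "V \<in> P" for V
        using that k h(1) by (fastforce simp: fiber_def XP bij_betw_def inj_on_def)
      have fP: "fiber X k ` S = P" using fib h(1) by (force simp: bij_betw_def)
      have "index_type X k = (P, r)"
      proof -
        have "{(fiber X k i, fiber X k j) | i j. i \<in> S \<and> j \<in> S \<and> j \<le> i} = r"
        proof (intro equalityI subrelI)
          fix V W assume "(V, W) \<in> {(fiber X k i, fiber X k j) | i j. i \<in> S \<and> j \<in> S \<and> j \<le> i}"
          then obtain i j where ij: "V = fiber X k i" "W = fiber X k j" "i \<in> S" "j \<in> S" "j \<le> i" by auto
          then obtain V' W' where "i = h V'" "j = h W'" "V' \<in> P" "W' \<in> P" using h(1) by (auto simp: bij_betw_def)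
          thus "(V, W) \<in> r" using ij h(2) fib by auto
        next
          fix V W assume VW: "(V, W) \<in> r"
          hence "V \<in> P" "W \<in> P" using P(2) by (auto simp: order_on_defs)
          hence "V = fiber X k (h V)" "W = fiber X k (h W)" "h V \<in> S" "h W \<in> S" "h W \<le> h V"
            using VW h fib by (auto simp: bij_betw_def)
          thus "(V, W) \<in> {(fiber X k i, fiber X k j) | i j. i \<in> S \<and> j \<in> S \<and> j \<le> i}" by blast
        qed
        thus ?thesis using fP by (simp add: index_type_def img)
      qed
      moreover have "k \<in> X \<rightarrow>\<^sub>E {1..N}"
        using img S by (auto simp: k_def)
      ultimately show ?thesis using img Pr by auto
    qed
    ultimately show "(\<lambda>k. k ` X) ` ?K = ?S" by blast
  qed
  hence "card ?K = card ?S" by (rule bij_betw_same_card)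
  also have "\<dots> = N choose n" using n_subsets[of "{1..N}" n] by simp
  finally show ?thesis .
qed

text \<open>
A function with at most \<open>m\<close> values factors through a set with \<open>m\<close> elements.
\<close>

lemma card_small_image_functions:
  assumes X: "finite X" "X \<noteq> {}"
  shows "card {k \<in> X \<rightarrow>\<^sub>E {1..N::nat}. card (k ` X) \<le> m} \<le> m ^ card X * N ^ m"
proof -
  let ?L = "{k \<in> X \<rightarrow>\<^sub>E {1..N}. card (k ` X) \<le> m}"
  let ?D = "({..<m} \<rightarrow>\<^sub>E {1..N}) \<times> (X \<rightarrow>\<^sub>E {..<m})"
  have "?L \<subseteq> (\<lambda>(g, h). \<lambda>t\<in>X. g (h t)) ` ?D"
  proof clarify
    fix k assume k: "k \<in> X \<rightarrow>\<^sub>E {1..N}" "card (k ` X) \<le> m"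
    obtain x where x: "x \<in> X" using X(2) by blast
    have "card (k ` X) \<le> card {..<m}" "finite (k ` X)" using k X by auto
    then obtain e where e: "e ` (k ` X) \<subseteq> {..<m}" "inj_on e (k ` X)"
      using card_le_inj[of "k ` X" "{..<m}"] by auto
    \<comment> \<open>The value at the points outside the range of e is arbitrary in {1..N}.\<close>
    define g where "g = (\<lambda>j\<in>{..<m}. if j \<in> e ` k ` X then inv_into (k ` X) e j else k x)"
    define h where "h = (\<lambda>t\<in>X. e (k t))"
    have "g \<in> {..<m} \<rightarrow>\<^sub>E {1..N}"
    proof -
      have "inv_into (k ` X) e j \<in> {1..N}" if "j \<in> e ` k ` X" for j
        using inv_into_into[OF that] k(1) by (auto simp: PiE_iff)
      thus ?thesis using k(1) x by (auto simp: g_def PiE_iff)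
    qed
    moreover have "h \<in> X \<rightarrow>\<^sub>E {..<m}" using e(1) by (auto simp: h_def)
    moreover have "k = (\<lambda>t\<in>X. g (h t))"
    proof
      fix t show "k t = (\<lambda>t\<in>X. g (h t)) t"
        using k(1) e by (cases "t \<in> X") (auto simp: g_def h_def PiE_iff extensional_def inv_into_f_f)
    qed
    ultimately show "k \<in> (\<lambda>(g, h). \<lambda>t\<in>X. g (h t)) ` ?D" by (intro image_eqI[of _ _ "(g, h)"]) auto
  qed
  moreover have fin: "finite ?D" using X by (auto intro!: finite_PiE)
  ultimately have "card ?L \<le> card ?D" by (meson card_image_le card_mono finite_imageI order_trans)
  also have "\<dots> = m ^ card X * N ^ m" using X by (simp add: card_cartesian_product card_PiE)
  finally show ?thesis .
qed

lemma card_eq_sum_fibers: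
  assumes "finite X" shows "card X = (\<Sum>i\<in>k ` X. card (fiber X k i))"
  using sum.image_gen[OF assms, of "\<lambda>_. 1::nat" k] by (simp add: fiber_def)

text \<open>
With at least \<open>n\<close> fibers on \<open>2n\<close> points and no fiber with one element, all fibers must be pairs.
\<close>

lemma singleton_fiber_exists:
  assumes X: "finite X" "card X = 2 * n" and "n \<le> card (k ` X)"
    and i: "i \<in> k ` X" "card (fiber X k i) \<noteq> 2"
  shows "\<exists>j. card (fiber X k j) = 1"
proof (rule ccontr)
  assume n: "\<nexists>j. card (fiber X k j) = 1"
  have ge: "2 \<le> card (fiber X k j)" if "j \<in> k ` X" for j
  proof -
    have "card (fiber X k j) \<noteq> 0" using that X by (auto simp: fiber_def)
    thus ?thesis using n[simplified, rule_format, of j] by linarith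
  qed
  have "(\<Sum>j\<in>k ` X. 2) < (\<Sum>j\<in>k ` X. card (fiber X k j))"
    using X(1) ge i by (intro sum_strict_mono_ex1) (auto intro!: bexI[of _ i] simp: order.strict_iff_order)
  thus False using assms(3) card_eq_sum_fibers[OF X(1), of k] X(2) by simp
qed

lemma binomial_over_power_tendsto:
  "(\<lambda>N. of_nat (N choose n) / of_nat N ^ n) \<longlonglongrightarrow> (1 / fact n :: complex)"
proof -
  have "(\<lambda>N. (\<Prod>i<n. 1 - of_nat i / of_nat N) / fact n) \<longlonglongrightarrow> (\<Prod>i<n. 1 - 0) / (fact n :: complex)"
    by (intro tendsto_intros lim_const_over_n) simp
  moreover have "\<forall>\<^sub>F N in sequentially. (\<Prod>i<n. 1 - of_nat i / of_nat N) / fact n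
      = (of_nat (N choose n) / of_nat N ^ n :: complex)"
    using eventually_gt_at_top[of 0]
  proof eventually_elim
    case (elim N)
    have "(of_nat (N choose n) :: complex) = (\<Prod>i<n. of_nat N - of_nat i) / fact n"
      by (simp add: binomial_gbinomial gbinomial_prod_rev atLeast0LessThan)
    moreover have "(\<Prod>i<n. 1 - of_nat i / of_nat N :: complex) = (\<Prod>i<n. (of_nat N - of_nat i) / of_nat N)"
      using elim by (intro prod.cong) (auto simp: field_simps)
    ultimately show ?case by (simp add: prod_dividef)
  qed
  ultimately show ?thesis by (simp add: tendsto_cong)
qed

text \<open>
The counting argument of the central limit theorem.  Index functions with a singleton fiber have
weight \<open>0\<close>, those with fewer than \<open>n\<close> values are \<open>O(N\<^sup>n\<^sup>-\<^sup>1)\<close> in number, and the remaining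
ones pair up the points; each ordered pair partition is the type of \<open>N choose n\<close> of them, which is
\<open>N\<^sup>n / n!\<close> asymptotically.
\<close>

lemma pair_index_sum_tendsto:
  fixes w :: "('x \<Rightarrow> nat) \<Rightarrow> complex"
  assumes X: "finite X" "card X = 2 * n"
    and bound: "\<And>k. norm (w k) \<le> C"
    and single: "\<And>k i. card (fiber X k i) = 1 \<Longrightarrow> w k = 0"
    and pair: "\<And>k. (\<And>i. i \<in> k ` X \<Longrightarrow> card (fiber X k i) = 2) \<Longrightarrow> w k = W (index_type X k)"
  shows "(\<lambda>N. (\<Sum>k\<in>X \<rightarrow>\<^sub>E {1..N}. w k) / of_nat N ^ n)
    \<longlonglongrightarrow> (\<Sum>\<tau>\<in>ordered_pair_partitions X. W \<tau>) / fact n"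
proof -
  let ?F = "\<lambda>N::nat. X \<rightarrow>\<^sub>E {1..N}"
  define low :: "nat \<Rightarrow> ('x \<Rightarrow> nat) set" where "low N = {k \<in> ?F N. card (k ` X) < n}" for N
  define pairs :: "nat \<Rightarrow> ('x \<Rightarrow> nat) set" where "pairs N = {k \<in> ?F N. \<forall>i\<in>k ` X. card (fiber X k i) = 2}" for N
  define E where "E N = (\<Sum>k\<in>low N. w k)" for N
  have fin: "finite (?F N)" for N using X by (auto intro!: finite_PiE)
  have disj: "low N \<inter> pairs N = {}" for N
  proof -
    have "card (k ` X) = n" if "k \<in> pairs N" for k
    proof -
      have "card X = (\<Sum>i\<in>k ` X. 2)" unfolding card_eq_sum_fibers[OF X(1), of k]
        using that by (intro sum.cong) (auto simp: pairs_def)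
      thus ?thesis using X(2) by simp
    qed
    thus ?thesis by (auto simp: low_def)
  qed
  have pairs_sum: "(\<Sum>k\<in>pairs N. w k) = of_nat (N choose n) * (\<Sum>\<tau>\<in>ordered_pair_partitions X. W \<tau>)" for N
  proof -
    have "(\<Sum>k\<in>pairs N. w k) = (\<Sum>k\<in>pairs N. W (index_type X k))"
      by (intro sum.cong refl pair) (auto simp: pairs_def)
    also have "\<dots> = (\<Sum>\<tau>\<in>ordered_pair_partitions X. \<Sum>k\<in>{k \<in> pairs N. index_type X k = \<tau>}. W (index_type X k))"
      using finite_ordered_pair_partitions[OF X(1)] fin[of N]
      by (intro sum.group[symmetric])
        (auto simp: pairs_def intro!: index_type_in_ordered_pair_partitions)
    also have "\<dots> = (\<Sum>\<tau>\<in>ordered_pair_partitions X. of_nat (N choose n) * W \<tau>)"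
    proof (rule sum.cong[OF refl])
      fix \<tau> assume \<tau>: "\<tau> \<in> ordered_pair_partitions X"
      have "{k \<in> pairs N. index_type X k = \<tau>} = {k \<in> ?F N. index_type X k = \<tau>}"
        using \<tau> by (auto simp: pairs_def ordered_pair_partitions_def index_type_def)
      thus "(\<Sum>k\<in>{k \<in> pairs N. index_type X k = \<tau>}. W (index_type X k)) = of_nat (N choose n) * W \<tau>"
        using card_index_functions_of_type[OF X \<tau>, of N] by simp
    qed
    finally show ?thesis by (simp add: sum_distrib_left)
  qed
  have total: "(\<Sum>k\<in>?F N. w k) = E N + of_nat (N choose n) * (\<Sum>\<tau>\<in>ordered_pair_partitions X. W \<tau>)" for N
  proof -
    have "(\<Sum>k\<in>?F N. w k) = (\<Sum>k\<in>low N \<union> pairs N. w k)"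
    proof (rule sum.mono_neutral_right[OF fin])
      show "\<forall>k\<in>?F N - (low N \<union> pairs N). w k = 0"
        using singleton_fiber_exists[OF X] single by (fastforce simp: low_def pairs_def not_less)
    qed (auto simp: low_def pairs_def)
    also have "\<dots> = E N + (\<Sum>k\<in>pairs N. w k)" unfolding E_def
      by (rule sum.union_disjoint) (use fin disj in \<open>auto simp: low_def pairs_def\<close>)
    finally show ?thesis by (simp add: pairs_sum)
  qed
  have "(\<lambda>N. E N / of_nat N ^ n) \<longlonglongrightarrow> 0"
  proof (cases "n = 0")
    case True
    thus ?thesis by (simp add: E_def low_def)
  next
    case False
    have C: "0 \<le> C" using bound[of undefined] norm_ge_zero order_trans by blast
    define D where "D = C * real ((n - 1) ^ card X)"
    have "norm (E N / of_nat N ^ n) \<le> D / real N" for N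
    proof -
      have "norm (E N) \<le> real (card (low N)) * C"
        unfolding E_def by (rule sum_norm_bound) (rule bound)
      also have "\<dots> \<le> real ((n - 1) ^ card X * N ^ (n - 1)) * C"
      proof (intro mult_right_mono C of_nat_mono)
        have "low N = {k \<in> ?F N. card (k ` X) \<le> n - 1}" using False by (auto simp: low_def)
        moreover have "X \<noteq> {}" using X(2) False by auto
        ultimately show "card (low N) \<le> (n - 1) ^ card X * N ^ (n - 1)"
          using card_small_image_functions[OF X(1)] by simp
      qed
      finally have "norm (E N) \<le> D * real N ^ (n - 1)" by (simp add: D_def mult_ac)
      moreover have "real N ^ n = real N ^ (n - 1) * real N" using False by (simp add: power_eq_if)
      ultimately show ?thesis
        using False by (cases "N = 0") (auto simp: norm_divide norm_power power_0_left field_simps)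
    qed
    hence "(\<lambda>N. norm (E N / of_nat N ^ n)) \<longlonglongrightarrow> 0"
      by (intro tendsto_sandwich[OF _ _ tendsto_const lim_const_over_n[of D]]) (simp_all only: norm_ge_zero eventually_True)
    thus ?thesis by (rule tendsto_norm_zero_cancel)
  qed
  from tendsto_add[OF this tendsto_mult[OF binomial_over_power_tendsto[of n] tendsto_const[of "\<Sum>\<tau>\<in>ordered_pair_partitions X. W \<tau>"]]]
  show ?thesis unfolding total by (simp add: add_divide_distrib)
qed

section \<open>Moments of sums\<close>

lemma linear_functional_finsum:
  assumes A: "unital_star_algebra A" and J: "finite J" "\<And>j. j \<in> J \<Longrightarrow> x j \<in> carrier A"
    and add: "\<And>u v. u \<in> carrier A \<Longrightarrow> v \<in> carrier A \<Longrightarrow> L (u \<oplus>\<^bsub>A\<^esub> v) = L u + L v"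
    and smult: "\<And>c u. u \<in> carrier A \<Longrightarrow> L (c \<odot>\<^bsub>A\<^esub> u) = c * (L u :: complex)"
  shows "L (\<Oplus>\<^bsub>A\<^esub>j\<in>J. x j) = (\<Sum>j\<in>J. L (x j))"
proof -
  interpret unital_star_algebra A by fact
  have "L \<zero>\<^bsub>A\<^esub> = 0" using add[of "\<zero>\<^bsub>A\<^esub>" "\<zero>\<^bsub>A\<^esub>"] by simp
  with J show ?thesis
    by (induction J rule: finite_induct) (auto simp: finsum_insert Pi_def add finsum_closed)
qed

lemma sum_PiE_insert:
  fixes g :: "('x \<Rightarrow> 'y) \<Rightarrow> complex"
  assumes "t \<notin> S"
  shows "(\<Sum>k\<in>insert t S \<rightarrow>\<^sub>E J. g k) = (\<Sum>k\<in>S \<rightarrow>\<^sub>E J. \<Sum>j\<in>J. g (k(t := j)))"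
proof -
  have "(\<Sum>k\<in>insert t S \<rightarrow>\<^sub>E J. g k) = (\<Sum>p\<in>J \<times> (S \<rightarrow>\<^sub>E J). g ((\<lambda>(y, k). k(t := y)) p))"
    unfolding PiE_insert_eq by (rule sum.reindex[OF inj_combinator[OF assms], unfolded o_def])
  also have "\<dots> = (\<Sum>j\<in>J. \<Sum>k\<in>S \<rightarrow>\<^sub>E J. g (k(t := j)))"
    by (simp add: sum.cartesian_product split_def)
  also have "\<dots> = (\<Sum>k\<in>S \<rightarrow>\<^sub>E J. \<Sum>j\<in>J. g (k(t := j)))" by (rule sum.swap)
  finally show ?thesis .
qed

text \<open>
Linearity of \<open>x \<mapsto> \<Phi>(y x z)\<close> expands one sum at a time.  The induction runs from the left, and
\<^term>\<open>y\<close> holds the factors that it has passed.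
\<close>

lemma state_product_of_sums:
  assumes prob: "nc_probability_space A \<Phi>" and J: "finite J"
    and x: "\<And>t j. j \<in> J \<Longrightarrow> x t j \<in> carrier A"
    and "distinct ts" "y \<in> carrier A"
  shows "\<Phi> (y \<otimes>\<^bsub>A\<^esub> list_product A (map (\<lambda>t. s \<odot>\<^bsub>A\<^esub> (\<Oplus>\<^bsub>A\<^esub>j\<in>J. x t j)) ts))
     = s ^ length ts * (\<Sum>k\<in>set ts \<rightarrow>\<^sub>E J. \<Phi> (y \<otimes>\<^bsub>A\<^esub> list_product A (map (\<lambda>t. x t (k t)) ts)))"
  using assms(4,5)
proof (induction ts arbitrary: y)
  case Nil
  thus ?case by (simp add: list_product_def)
next
  case (Cons t ts)
  have A: "unital_star_algebra A" and \<Phi>: "state A \<Phi>" using prob by (auto simp: nc_probability_space_def)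
  interpret unital_star_algebra A by fact
  have smc: "c \<odot>\<^bsub>A\<^esub> u \<in> carrier A" if "u \<in> carrier A" for c u
    using smult_closed[of c u] that by (simp add: complex_field_def)
  let ?X = "\<lambda>t. \<Oplus>\<^bsub>A\<^esub>j\<in>J. x t j"
  have X: "?X t \<in> carrier A" for t using x by (intro finsum_closed) auto
  let ?R = "\<lambda>k. list_product A (map (\<lambda>t. x t (k t)) ts)"
  have R: "?R k \<in> carrier A" if "k \<in> set ts \<rightarrow>\<^sub>E J" for k
    using that x by (intro list_product_closed[OF A]) (auto simp: PiE_iff)
  have R0: "list_product A (map (\<lambda>t. s \<odot>\<^bsub>A\<^esub> ?X t) ts) \<in> carrier A"
    using X smc by (intro list_product_closed[OF A]) auto
  have y: "y \<in> carrier A" and t: "t \<notin> set ts" "distinct ts" using Cons.prems by auto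
  have step: "\<Phi> (y \<otimes>\<^bsub>A\<^esub> (s \<odot>\<^bsub>A\<^esub> ?X t) \<otimes>\<^bsub>A\<^esub> z) = s * (\<Sum>j\<in>J. \<Phi> (y \<otimes>\<^bsub>A\<^esub> (x t j \<otimes>\<^bsub>A\<^esub> z)))"
    if z: "z \<in> carrier A" for z
  proof -
    have lin: "\<Phi> (y \<otimes>\<^bsub>A\<^esub> (u \<oplus>\<^bsub>A\<^esub> v) \<otimes>\<^bsub>A\<^esub> z) = \<Phi> (y \<otimes>\<^bsub>A\<^esub> u \<otimes>\<^bsub>A\<^esub> z) + \<Phi> (y \<otimes>\<^bsub>A\<^esub> v \<otimes>\<^bsub>A\<^esub> z)"
      "\<Phi> (y \<otimes>\<^bsub>A\<^esub> (c \<odot>\<^bsub>A\<^esub> u) \<otimes>\<^bsub>A\<^esub> z) = c * \<Phi> (y \<otimes>\<^bsub>A\<^esub> u \<otimes>\<^bsub>A\<^esub> z)"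
      if "u \<in> carrier A" "v \<in> carrier A" for u v c
      using \<Phi> that y z by (auto simp: state_def mult_l_distr mult_r_distr smult_mult_l smult_mult_r mult_closed)
    have "\<Phi> (y \<otimes>\<^bsub>A\<^esub> ?X t \<otimes>\<^bsub>A\<^esub> z) = (\<Sum>j\<in>J. \<Phi> (y \<otimes>\<^bsub>A\<^esub> x t j \<otimes>\<^bsub>A\<^esub> z))"
      by (rule linear_functional_finsum[OF A J, where L = "\<lambda>u. \<Phi> (y \<otimes>\<^bsub>A\<^esub> u \<otimes>\<^bsub>A\<^esub> z)"]) (use x lin in auto)
    thus ?thesis using lin(2)[OF X X] x y z by (simp add: mult_assoc)
  qed
  have "\<Phi> (y \<otimes>\<^bsub>A\<^esub> list_product A (map (\<lambda>t. s \<odot>\<^bsub>A\<^esub> ?X t) (t # ts)))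
      = \<Phi> (y \<otimes>\<^bsub>A\<^esub> (s \<odot>\<^bsub>A\<^esub> ?X t) \<otimes>\<^bsub>A\<^esub> list_product A (map (\<lambda>t. s \<odot>\<^bsub>A\<^esub> ?X t) ts))"
    using mult_assoc[OF y smc[OF X] R0] by (simp add: list_product_def)
  also have "\<dots> = s ^ length ts * (\<Sum>k\<in>set ts \<rightarrow>\<^sub>E J. \<Phi> (y \<otimes>\<^bsub>A\<^esub> (s \<odot>\<^bsub>A\<^esub> ?X t) \<otimes>\<^bsub>A\<^esub> ?R k))"
    by (rule Cons.IH) (use t y X smc mult_closed in auto)
  also have "\<dots> = s ^ length ts * (\<Sum>k\<in>set ts \<rightarrow>\<^sub>E J. s * (\<Sum>j\<in>J. \<Phi> (y \<otimes>\<^bsub>A\<^esub> (x t j \<otimes>\<^bsub>A\<^esub> ?R k))))"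
    by (intro arg_cong2[where f = "(*)"] sum.cong refl step R)
  also have "\<dots> = s ^ length (t # ts) * (\<Sum>k\<in>set ts \<rightarrow>\<^sub>E J. \<Sum>j\<in>J. \<Phi> (y \<otimes>\<^bsub>A\<^esub> (x t j \<otimes>\<^bsub>A\<^esub> ?R k)))"
    by (simp add: sum_distrib_left mult_ac)
  also have "(\<Sum>k\<in>set ts \<rightarrow>\<^sub>E J. \<Sum>j\<in>J. \<Phi> (y \<otimes>\<^bsub>A\<^esub> (x t j \<otimes>\<^bsub>A\<^esub> ?R k)))
      = (\<Sum>k\<in>set (t # ts) \<rightarrow>\<^sub>E J. \<Phi> (y \<otimes>\<^bsub>A\<^esub> list_product A (map (\<lambda>t. x t (k t)) (t # ts))))"
  proof -
    have "list_product A (map (\<lambda>u. x u ((k(t := j)) u)) (t # ts)) = x t j \<otimes>\<^bsub>A\<^esub> ?R k" for k j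
    proof -
      have tail: "map (\<lambda>u. x u ((k(t := j)) u)) ts = map (\<lambda>u. x u (k u)) ts"
        using t(1) by (intro map_cong) auto
      show ?thesis unfolding list_product_def list.map tail by simp
    qed
    thus ?thesis unfolding list.set(2) sum_PiE_insert[OF t(1)] by simp
  qed
  finally show ?case .
qed

section \<open>Moments of a single leg\<close>

lemma leg_moment_append_absent:
  assumes "\<mu> [] = 1" "i \<notin> snd ` set us"
  shows "leg_moment \<mu> i [] (us @ vs) = leg_moment \<mu> i [] vs"
  using assms(2) by (induction us) (auto simp: assms(1))

lemma leg_moment_absent:
  assumes "\<mu> [] = 1" "i \<notin> snd ` set us"
  shows "leg_moment \<mu> i ps us = \<mu> ps"
  using assms(2) by (induction us arbitrary: ps) (auto simp: assms(1))

text \<open>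
A vacuum projection behind a single centered letter splits off the factor \<open>\<mu> [p] = 0\<close>.
\<close>

lemma leg_moment_after_centered:
  assumes "\<mu> [p] = 0" "i \<notin> snd ` set us"
  shows "leg_moment \<mu> i [p] (us @ vs) =
    (if \<exists>(q, k)\<in>set us. vacuum_hit q k i then 0 else leg_moment \<mu> i [p] vs)"
  using assms(2) by (induction us) (auto simp: assms(1))

text \<open>
A leg moment is a product of moments \<^term>\<open>\<mu> ps\<close>, with one factor for each closed group of letters
and one for the last group; each projection closes at most one group.
\<close>

lemma norm_leg_moment_le:
  assumes "1 \<le> C" "\<And>ps. length ps \<le> m \<Longrightarrow> norm (\<mu> ps) \<le> C" "length ps + length us \<le> m"
  shows "norm (leg_moment \<mu> i ps us) \<le> C ^ Suc (length us)"
  using assms(3)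
proof (induction us arbitrary: ps)
  case Nil
  thus ?case using assms(2) by simp
next
  case (Cons a us)
  obtain p k where a: "a = (p, k)" by force
  have mono: "C ^ Suc (length us) \<le> C * C ^ Suc (length us)"
    using mult_right_mono[OF assms(1), of "C ^ Suc (length us)"] assms(1) by simp
  have 1: "norm (leg_moment \<mu> i (ps @ [p]) us) \<le> C ^ Suc (length us)"
    "norm (leg_moment \<mu> i ps us) \<le> C ^ Suc (length us)"
    "norm (leg_moment \<mu> i [] us) \<le> C ^ Suc (length us)"
    using Cons.prems by (auto intro!: Cons.IH simp del: power_Suc)
  have "norm (\<mu> ps) * norm (leg_moment \<mu> i [] us) \<le> C * C ^ Suc (length us)"
    using 1(3) assms(1) Cons.prems by (intro mult_mono assms(2)) auto
  with 1 mono show ?case by (auto simp: a norm_mult)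
qed

definition indexed_word :: "(nat \<Rightarrow> face) \<Rightarrow> (nat \<Rightarrow> nat) \<Rightarrow> nat list \<Rightarrow> (face \<times> nat) list" where
  "indexed_word \<delta> k ts = map (\<lambda>t. (\<delta> t, k t)) ts"

lemma indices_indexed_word: "snd ` set (indexed_word \<delta> k ts) = k ` set ts"
  by (force simp: indexed_word_def)

lemma upt_split: "i \<le> j \<Longrightarrow> j \<le> m \<Longrightarrow> [i..<m] = [i..<j] @ [j..<m]"
  using upt_add_eq_append[of i j "m - j"] by simp

lemma leg_moment_singleton:
  assumes \<mu>: "\<mu> [] = 1" "\<And>p. \<mu> [p] = 0" and f: "fiber {1..m} k i = {a}"
  shows "leg_moment \<mu> i [] (indexed_word \<delta> k [1..<Suc m]) = 0"
proof -
  have a: "1 \<le> a" "a \<le> m" "k a = i" and n: "\<And>t. 1 \<le> t \<Longrightarrow> t \<le> m \<Longrightarrow> k t = i \<Longrightarrow> t = a"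
    using f by (auto simp: fiber_def)
  have absent: "i \<notin> snd ` set (indexed_word \<delta> k ts)" if "\<And>t. t \<in> set ts \<Longrightarrow> 1 \<le> t \<and> t \<le> m \<and> t \<noteq> a" for ts
    unfolding indices_indexed_word using n that by blast
  have "[1..<Suc m] = [1..<a] @ a # [Suc a..<Suc m]"
    using a upt_split[of 1 a "Suc m"] by (simp add: upt_conv_Cons)
  hence "leg_moment \<mu> i [] (indexed_word \<delta> k [1..<Suc m])
      = leg_moment \<mu> i [] (indexed_word \<delta> k [1..<a] @ (\<delta> a, i) # indexed_word \<delta> k [Suc a..<Suc m])"
    using a by (simp add: indexed_word_def)
  also have "\<dots> = leg_moment \<mu> i [] ((\<delta> a, i) # indexed_word \<delta> k [Suc a..<Suc m])"
    by (rule leg_moment_append_absent[where \<mu> = \<mu>, OF \<mu>(1)]) (rule absent, use a in auto)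
  also have "\<dots> = leg_moment \<mu> i [\<delta> a] (indexed_word \<delta> k [Suc a..<Suc m])" by simp
  also have "\<dots> = \<mu> [\<delta> a]"
    by (rule leg_moment_absent[where \<mu> = \<mu>, OF \<mu>(1)]) (rule absent, use a in auto)
  finally show ?thesis using \<mu>(2) by simp
qed

text \<open>
On the leg of the pair \<open>{a, c}\<close> the word reads \<open>\<dots> b\<^sub>a \<dots> b\<^sub>c \<dots>\<close>, and only what stands between the
two letters matters: projections outside act trivially on the vacuum, one inside separates the two
centered letters.
\<close>

lemma leg_moment_pair:
  assumes \<mu>: "\<mu> [] = 1" "\<And>p. \<mu> [p] = 0" and f: "fiber {1..m} k i = {a, c}" "a < c"
  shows "leg_moment \<mu> i [] (indexed_word \<delta> k [1..<Suc m]) =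
    (if \<exists>t. a < t \<and> t < c \<and> vacuum_hit (\<delta> t) (k t) i then 0 else \<mu> [\<delta> a, \<delta> c])"
proof -
  have "a \<in> fiber {1..m} k i" "c \<in> fiber {1..m} k i" using f by auto
  hence a: "1 \<le> a" "k a = i" "c \<le> m" "k c = i" by (auto simp: fiber_def)
  have n: "\<And>t. 1 \<le> t \<Longrightarrow> t \<le> m \<Longrightarrow> k t = i \<Longrightarrow> t = a \<or> t = c"
    using f(1) by (auto simp: fiber_def set_eq_iff)
  have absent: "i \<notin> snd ` set (indexed_word \<delta> k ts)"
    if "\<And>t. t \<in> set ts \<Longrightarrow> 1 \<le> t \<and> t \<le> m \<and> t \<noteq> a \<and> t \<noteq> c" for ts
    unfolding indices_indexed_word using n that by blast
  have "[1..<Suc m] = [1..<a] @ [a..<Suc m]" using a f(2) upt_split[of 1 a "Suc m"] by simp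
  moreover have "[a..<Suc m] = a # [Suc a..<Suc m]" using a f(2) by (simp add: upt_conv_Cons)
  moreover have "[Suc a..<Suc m] = [Suc a..<c] @ [c..<Suc m]"
    using a f(2) upt_split[of "Suc a" c "Suc m"] by simp
  moreover have "[c..<Suc m] = c # [Suc c..<Suc m]" using a by (simp add: upt_conv_Cons)
  ultimately have "leg_moment \<mu> i [] (indexed_word \<delta> k [1..<Suc m])
      = leg_moment \<mu> i [] (indexed_word \<delta> k [1..<a] @ (\<delta> a, i) # indexed_word \<delta> k [Suc a..<c]
          @ (\<delta> c, i) # indexed_word \<delta> k [Suc c..<Suc m])"
    using a by (simp add: indexed_word_def)
  also have "\<dots> = leg_moment \<mu> i [\<delta> a] (indexed_word \<delta> k [Suc a..<c] @ (\<delta> c, i) # indexed_word \<delta> k [Suc c..<Suc m])"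
    by (subst leg_moment_append_absent[where \<mu> = \<mu>, OF \<mu>(1) absent]) (use a f(2) in auto)
  also have "\<dots> = (if \<exists>(q, l)\<in>set (indexed_word \<delta> k [Suc a..<c]). vacuum_hit q l i then 0
      else leg_moment \<mu> i [\<delta> a] ((\<delta> c, i) # indexed_word \<delta> k [Suc c..<Suc m]))"
    by (rule leg_moment_after_centered[where \<mu> = \<mu>, OF \<mu>(2)]) (rule absent, use a f(2) in auto)
  also have "leg_moment \<mu> i [\<delta> a] ((\<delta> c, i) # indexed_word \<delta> k [Suc c..<Suc m])
      = leg_moment \<mu> i [\<delta> a, \<delta> c] (indexed_word \<delta> k [Suc c..<Suc m])" by simp
  also have "\<dots> = \<mu> [\<delta> a, \<delta> c]"
    by (rule leg_moment_absent[where \<mu> = \<mu>, OF \<mu>(1)]) (rule absent, use a f(2) in auto)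
  also have "(\<exists>(q, l)\<in>set (indexed_word \<delta> k [Suc a..<c]). vacuum_hit q l i)
      \<longleftrightarrow> (\<exists>t. a < t \<and> t < c \<and> vacuum_hit (\<delta> t) (k t) i)"
    by (auto simp: indexed_word_def Suc_le_eq)
  finally show ?thesis .
qed

section \<open>Bi-monotone pair partitions\<close>

text \<open>
A letter strictly inside a pair lies in a different block, so its index and that of the pair differ.
The order that bi-monotonicity demands between the two blocks is the one for which a letter of that
face leaves the leg of the pair alone.
\<close>

lemma bimonotone_index_type_iff:
  fixes X :: "nat set"
  assumes pair: "\<And>i. i \<in> k ` X \<Longrightarrow> card (fiber X k i) = 2"
  shows "bimonotone_partition \<delta> (fst (index_type X k)) (snd (index_type X k)) \<longleftrightarrow>
    (\<forall>i\<in>k ` X. \<nexists>t. t \<in> X \<and> Min (fiber X k i) < t \<and> t < Max (fiber X k i) \<and> vacuum_hit (\<delta> t) (k t) i)"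
proof -
  have order: "((fiber X k i, fiber X k j) \<in> snd (index_type X k)) \<longleftrightarrow> j \<le> i" if "i \<in> k ` X" "j \<in> k ` X" for i j
    by (rule index_type_order_iff[OF that])
  have bl: "fst (index_type X k) = fiber X k ` k ` X" by (simp add: index_type_def)
  have "bimonotone_partition \<delta> (fst (index_type X k)) (snd (index_type X k)) \<longleftrightarrow>
    (\<forall>i\<in>k ` X. \<forall>j\<in>k ` X. \<forall>a\<in>fiber X k i. \<forall>c\<in>fiber X k i. \<forall>t\<in>fiber X k j. a < t \<and> t < c \<longrightarrow>
       (\<delta> t = Right \<longrightarrow> i \<le> j) \<and> (\<delta> t = Left \<longrightarrow> j \<le> i))"
    unfolding bimonotone_partition_def bl by (simp add: order)
  also have "\<dots> \<longleftrightarrow> (\<forall>i\<in>k ` X. \<forall>t\<in>X. \<forall>a\<in>fiber X k i. \<forall>c\<in>fiber X k i. a < t \<and> t < c \<longrightarrow> \<not> vacuum_hit (\<delta> t) (k t) i)"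
    by (fastforce simp: fiber_def vacuum_hit_def split: face.splits)
  also have "\<dots> \<longleftrightarrow> (\<forall>i\<in>k ` X. \<nexists>t. t \<in> X \<and> Min (fiber X k i) < t \<and> t < Max (fiber X k i) \<and> vacuum_hit (\<delta> t) (k t) i)"
  proof (intro ball_cong refl)
    fix i assume "i \<in> k ` X"
    hence c: "card (fiber X k i) = 2" by (rule pair)
    hence "finite (fiber X k i)" "fiber X k i \<noteq> {}" by (auto intro: card_ge_0_finite)
    hence "(\<exists>a\<in>fiber X k i. \<exists>c\<in>fiber X k i. a < t \<and> t < c) \<longleftrightarrow> Min (fiber X k i) < t \<and> t < Max (fiber X k i)" for t
      by (auto simp: Min_less_iff Max_gr_iff)
    thus "(\<forall>t\<in>X. \<forall>a\<in>fiber X k i. \<forall>c\<in>fiber X k i. a < t \<and> t < c \<longrightarrow> \<not> vacuum_hit (\<delta> t) (k t) i) =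
        (\<nexists>t. t \<in> X \<and> Min (fiber X k i) < t \<and> t < Max (fiber X k i) \<and> vacuum_hit (\<delta> t) (k t) i)" by blast
  qed
  finally show ?thesis .
qed

lemma prod_leg_moments_of_pairs:
  assumes \<mu>: "\<mu> [] = 1" "\<And>p. \<mu> [p] = 0"
    and pair: "\<And>i. i \<in> k ` {1..m} \<Longrightarrow> card (fiber {1..m} k i) = 2"
  shows "(\<Prod>i\<in>k ` {1..m}. leg_moment \<mu> i [] (indexed_word \<delta> k [1..<Suc m])) =
    (case index_type {1..m} k of (P, r) \<Rightarrow>
      if bimonotone_partition \<delta> P r then \<Prod>V\<in>P. \<mu> [\<delta> (Min V), \<delta> (Max V)] else 0)"
proof -
  let ?X = "{1..m}"
  let ?hit = "\<lambda>i t. Min (fiber ?X k i) < t \<and> t < Max (fiber ?X k i) \<and> vacuum_hit (\<delta> t) (k t) i"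
  let ?l = "\<lambda>i. leg_moment \<mu> i [] (indexed_word \<delta> k [1..<Suc m])"
  have leg: "?l i = (if \<exists>t. t \<in> ?X \<and> ?hit i t then 0
      else \<mu> [\<delta> (Min (fiber ?X k i)), \<delta> (Max (fiber ?X k i))])" if i: "i \<in> k ` ?X" for i
  proof -
    obtain a c where "fiber ?X k i = {a, c}" "a \<noteq> c" using pair[OF i] by (auto simp: card_2_iff)
    then obtain a c where f: "fiber ?X k i = {a, c}" "a < c" by (metis insert_commute linorder_neqE_nat)
    hence mm: "Min (fiber ?X k i) = a" "Max (fiber ?X k i) = c" by auto
    have "a \<in> ?X" "c \<in> ?X" using f by (auto simp: fiber_def)
    hence "(\<exists>t. a < t \<and> t < c \<and> vacuum_hit (\<delta> t) (k t) i) \<longleftrightarrow> (\<exists>t. t \<in> ?X \<and> ?hit i t)"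
      unfolding mm by (intro iff_exI) auto
    thus ?thesis unfolding leg_moment_pair[OF \<mu> f] mm by simp
  qed
  have bl: "fst (index_type ?X k) = fiber ?X k ` k ` ?X" by (simp add: index_type_def)
  have bimonotone_iff: "bimonotone_partition \<delta> (fst (index_type ?X k)) (snd (index_type ?X k)) \<longleftrightarrow>
      (\<forall>i\<in>k ` ?X. \<nexists>t. t \<in> ?X \<and> ?hit i t)"
    by (rule bimonotone_index_type_iff) (rule pair)
  show ?thesis
  proof (cases "bimonotone_partition \<delta> (fst (index_type ?X k)) (snd (index_type ?X k))")
    case True
    have "?l i = \<mu> [\<delta> (Min (fiber ?X k i)), \<delta> (Max (fiber ?X k i))]" if i: "i \<in> k ` ?X" for i
    proof -
      have "\<not> (\<exists>t. t \<in> ?X \<and> ?hit i t)"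
        using True i unfolding bimonotone_iff by blast
      thus ?thesis by (simp only: leg[OF i] if_False)
    qed
    hence "(\<Prod>i\<in>k ` ?X. ?l i) = (\<Prod>i\<in>k ` ?X. \<mu> [\<delta> (Min (fiber ?X k i)), \<delta> (Max (fiber ?X k i))])"
      by (rule prod.cong[OF refl])
    also have "\<dots> = (\<Prod>V\<in>fst (index_type ?X k). \<mu> [\<delta> (Min V), \<delta> (Max V)])"
      unfolding bl by (simp add: prod.reindex[OF fiber_inj])
    finally show ?thesis using True by (simp add: split_def)
  next
    case False
    then obtain i where "i \<in> k ` ?X" "\<exists>t. t \<in> ?X \<and> ?hit i t"
      unfolding bimonotone_iff by blast
    hence "i \<in> k ` ?X" "?l i = 0" by (simp_all only: leg if_True)
    hence "(\<Prod>i\<in>k ` ?X. ?l i) = 0" by (intro prod_zero) auto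
    thus ?thesis using False by (simp add: split_def)
  qed
qed

section \<open>The central limit theorem\<close>

theorem theorem6p5:
  fixes A :: "'a star_algebra" and \<Phi> :: "'a \<Rightarrow> complex"
    and b :: "face \<Rightarrow> nat \<Rightarrow> 'a" and c :: "face \<Rightarrow> face \<Rightarrow> complex"
    and n :: nat and \<delta> :: "nat \<Rightarrow> face"
  assumes prob: "nc_probability_space A \<Phi>"
    and elements: "\<And>p k. k \<ge> 1 \<Longrightarrow> b p k \<in> carrier A"
    and centered: "\<And>p k. k \<ge> 1 \<Longrightarrow> \<Phi> (b p k) = 0"
    and indep: "bimonotone_independent_sequence A \<Phi> (\<lambda>k p. b p k)"
    and identical: "\<And>k m. k \<ge> 1 \<Longrightarrow> m \<ge> 1 \<Longrightarrow>
      pair_distribution A \<Phi> (\<lambda>p. b p k) = pair_distribution A \<Phi> (\<lambda>p. b p m)"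
    and c_def: "\<And>p q k. k \<ge> 1 \<Longrightarrow> c p q = \<Phi> (b p k \<otimes>\<^bsub>A\<^esub> b q k)"
  shows "(\<lambda>N. \<Phi> (list_product A
            (map (\<lambda>i. complex_of_real (1 / sqrt (real N)) \<odot>\<^bsub>A\<^esub> (\<Oplus>\<^bsub>A\<^esub>k\<in>{1..N}. b (\<delta> i) k)) [1..<2 * n + 1])))
         \<longlonglongrightarrow> 1 / fact n * (\<Sum>(P, r)\<in>bimonotone_pair_partitions n \<delta>. \<Prod>V\<in>P. c (\<delta> (Min V)) (\<delta> (Max V)))"
proof -
  have A: "unital_star_algebra A" and state: "state A \<Phi>" using prob by (auto simp: nc_probability_space_def)
  interpret unital_star_algebra A by fact
  define X where "X = {1..2 * n}"
  define \<mu> where "\<mu> = pair_distribution A \<Phi> (\<lambda>p. b p 1)"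
  let ?us = "\<lambda>k. indexed_word \<delta> k [1..<Suc (2 * n)]"
  define w where "w k = (\<Prod>i\<in>k ` X. leg_moment \<mu> i [] (?us k))" for k
  let ?W = "\<lambda>(P, r). if bimonotone_partition \<delta> P r then \<Prod>V\<in>P. \<mu> [\<delta> (Min V), \<delta> (Max V)] else 0"
  have X: "finite X" "card X = 2 * n" and set_upt: "set [1..<Suc (2 * n)] = X" by (auto simp: X_def)
  have \<mu>: "\<mu> [] = 1" "\<mu> [p] = 0" "\<mu> [p, q] = c p q" for p q
    using state elements[of 1] centered[of 1 p] c_def[of 1 p q]
    by (simp_all add: \<mu>_def pair_distribution_def list_product_def state_def)
  have moment: "\<Phi> (list_product A (map (\<lambda>t. b (\<delta> t) (k t)) [1..<Suc (2 * n)])) = w k"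
    if k: "k \<in> X \<rightarrow>\<^sub>E {1..N}" for N k
  proof (cases "N = 0")
    case True
    hence "X = {}" using k by (auto simp: PiE_iff)
    hence "n = 0" using X by simp
    thus ?thesis using \<mu>(1) state by (simp add: w_def X_def list_product_def state_def)
  next
    case False
    have us: "snd ` set (?us k) = k ` X" by (simp only: indices_indexed_word set_upt)
    have "\<Phi> (list_product A (map (\<lambda>(p, i). b p i) (?us k)))
        = (\<Prod>i\<in>{1..N}. leg_moment (pair_distribution A \<Phi> (\<lambda>p. b p i)) i [] (?us k))"
    proof (rule joint_moment_factorizes[OF prob])
      show "bimonotone_independent_pairs A \<Phi> N (\<lambda>k p. b p k)"
        using indep False by (simp add: bimonotone_independent_sequence_def)
      show "snd ` set (?us k) \<subseteq> {1..N}" using k unfolding us by auto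
    qed (use elements in auto)
    also have "\<dots> = (\<Prod>i\<in>{1..N}. leg_moment \<mu> i [] (?us k))"
      unfolding \<mu>_def by (intro prod.cong refl arg_cong[where f = "\<lambda>\<mu>. leg_moment \<mu> _ [] _"] identical) auto
    also have "\<dots> = w k" unfolding w_def
    proof (rule prod.mono_neutral_right)
      show "k ` X \<subseteq> {1..N}" using k by auto
      show "\<forall>i\<in>{1..N} - k ` X. leg_moment \<mu> i [] (?us k) = 1"
      proof
        fix i assume "i \<in> {1..N} - k ` X"
        hence "i \<notin> snd ` set (?us k)" unfolding us by blast
        from leg_moment_absent[where \<mu> = \<mu>, OF \<mu>(1) this] show "leg_moment \<mu> i [] (?us k) = 1"
          using \<mu>(1) by simp
      qed
    qed simp
    finally show ?thesis by (simp add: indexed_word_def o_def)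
  qed
  \<comment> \<open>Only finitely many face words of length at most 2 * n occur, so their moments have a common bound.\<close>
  have "finite (UNIV :: face set)"
    by (rule finite_subset[of _ "{Left, Right}"]) (use face.exhaust in auto)
  hence fin: "finite {ps :: face list. length ps \<le> 2 * n}"
    using finite_lists_length_le[of "UNIV :: face set" "2 * n"] by simp
  define C where "C = 1 + (\<Sum>ps\<in>{ps. length ps \<le> 2 * n}. norm (\<mu> ps))"
  have C1: "1 \<le> C" by (simp add: C_def sum_nonneg)
  have C: "norm (\<mu> ps) \<le> C" if "length ps \<le> 2 * n" for ps
    using member_le_sum[of ps "{ps. length ps \<le> 2 * n}" "\<lambda>ps. norm (\<mu> ps)"] that fin
    by (simp add: C_def)
  have bound: "norm (w k) \<le> (C ^ Suc (2 * n)) ^ (2 * n)" for k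
  proof -
    have "norm (w k) \<le> (\<Prod>i\<in>k ` X. C ^ Suc (2 * n))"
      unfolding w_def prod_norm[symmetric]
    proof (rule prod_mono)
      fix i assume "i \<in> k ` X"
      have len: "length (?us k) = 2 * n" by (simp add: indexed_word_def)
      have "norm (leg_moment \<mu> i [] (?us k)) \<le> C ^ Suc (length (?us k))"
      proof (rule norm_leg_moment_le[where m = "2 * n", OF C1])
        show "length [] + length (?us k) \<le> 2 * n" by (simp only: len list.size add_0 order_refl)
      qed (rule C)
      thus "0 \<le> norm (leg_moment \<mu> i [] (?us k)) \<and> norm (leg_moment \<mu> i [] (?us k)) \<le> C ^ Suc (2 * n)"
        unfolding len by simp
    qed
    also have "\<dots> = (C ^ Suc (2 * n)) ^ card (k ` X)" by simp
    also have "\<dots> \<le> (C ^ Suc (2 * n)) ^ (2 * n)"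
      using card_image_le[OF X(1), of k] X(2) one_le_power[OF C1, of "Suc (2 * n)"]
      by (intro power_increasing) (simp_all del: power_Suc)
    finally show ?thesis .
  qed
  have single: "w k = 0" if "card (fiber X k i) = 1" for k i
  proof -
    obtain a where a: "fiber X k i = {a}" using \<open>card (fiber X k i) = 1\<close> card_1_singletonE by blast
    hence "a \<in> fiber X k i" by simp
    hence "i \<in> k ` X" by (auto simp: fiber_def)
    moreover have "leg_moment \<mu> i [] (?us k) = 0"
      using leg_moment_singleton[where \<mu> = \<mu>, OF \<mu>(1,2)] a unfolding X_def by blast
    ultimately show ?thesis unfolding w_def using X(1) by (intro prod_zero) auto
  qed
  have pair: "w k = ?W (index_type X k)" if "\<And>i. i \<in> k ` X \<Longrightarrow> card (fiber X k i) = 2" for k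
    using prod_leg_moments_of_pairs[where \<mu> = \<mu>, OF \<mu>(1,2), of k "2 * n" \<delta>] that
    unfolding w_def X_def by blast
  \<comment> \<open>A unit in front brings the product into the form of the multilinear expansion.\<close>
  have "\<Phi> (list_product A (map (\<lambda>i. complex_of_real (1 / sqrt (real N)) \<odot>\<^bsub>A\<^esub> (\<Oplus>\<^bsub>A\<^esub>k\<in>{1..N}. b (\<delta> i) k)) [1..<2 * n + 1]))
      = (\<Sum>k\<in>X \<rightarrow>\<^sub>E {1..N}. w k) / of_nat N ^ n" for N
  proof -
    let ?s = "complex_of_real (1 / sqrt (real N))"
    let ?p = "\<lambda>k. list_product A (map (\<lambda>t. b (\<delta> t) (k t)) [1..<Suc (2 * n)])"
    let ?q = "list_product A (map (\<lambda>t. ?s \<odot>\<^bsub>A\<^esub> (\<Oplus>\<^bsub>A\<^esub>j\<in>{1..N}. b (\<delta> t) j)) [1..<Suc (2 * n)])"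
    have q: "?q \<in> carrier A"
      using elements by (intro list_product_closed[OF A])
        (auto intro!: smult_closed[unfolded complex_field_def, simplified] finsum_closed)
    have p: "?p k \<in> carrier A" if "k \<in> X \<rightarrow>\<^sub>E {1..N}" for k
      using that elements by (intro list_product_closed[OF A]) (force simp: X_def PiE_iff)
    have "\<Phi> (\<one>\<^bsub>A\<^esub> \<otimes>\<^bsub>A\<^esub> ?q) = ?s ^ length [1..<Suc (2 * n)] *
        (\<Sum>k\<in>set [1..<Suc (2 * n)] \<rightarrow>\<^sub>E {1..N}. \<Phi> (\<one>\<^bsub>A\<^esub> \<otimes>\<^bsub>A\<^esub> ?p k))"
      by (rule state_product_of_sums[OF prob]) (use elements in auto)
    also have "\<dots> = ?s ^ (2 * n) * (\<Sum>k\<in>X \<rightarrow>\<^sub>E {1..N}. w k)"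
    proof -
      have len: "length [1..<Suc (2 * n)] = 2 * n" by simp
      have "\<Phi> (\<one>\<^bsub>A\<^esub> \<otimes>\<^bsub>A\<^esub> ?p k) = w k" if "k \<in> X \<rightarrow>\<^sub>E {1..N}" for k
        unfolding l_one[OF p[OF that]] by (rule moment[OF that])
      hence "(\<Sum>k\<in>X \<rightarrow>\<^sub>E {1..N}. \<Phi> (\<one>\<^bsub>A\<^esub> \<otimes>\<^bsub>A\<^esub> ?p k)) = (\<Sum>k\<in>X \<rightarrow>\<^sub>E {1..N}. w k)"
        by (rule sum.cong[OF refl])
      thus ?thesis unfolding set_upt len by (rule arg_cong)
    qed
    also have "?s ^ (2 * n) = 1 / of_nat N ^ n"
    proof -
      have "?s ^ (2 * n) = complex_of_real ((1 / sqrt (real N)) ^ 2) ^ n"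
        by (simp only: of_real_power power_mult)
      thus ?thesis by (simp add: power_divide)
    qed
    finally show ?thesis unfolding l_one[OF q] by simp
  qed
  moreover have "(\<Sum>\<tau>\<in>ordered_pair_partitions X. ?W \<tau>)
      = (\<Sum>(P, r)\<in>bimonotone_pair_partitions n \<delta>. \<Prod>V\<in>P. c (\<delta> (Min V)) (\<delta> (Max V)))"
    by (rule sum.mono_neutral_cong_right[OF finite_ordered_pair_partitions[OF X(1)]])
      (auto simp: ordered_pair_partitions_def
        bimonotone_pair_partitions_def X_def \<mu> split: if_splits)
  moreover have "(\<lambda>N. (\<Sum>k\<in>X \<rightarrow>\<^sub>E {1..N}. w k) / of_nat N ^ n)
      \<longlonglongrightarrow> (\<Sum>\<tau>\<in>ordered_pair_partitions X. ?W \<tau>) / fact n"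
    by (rule pair_index_sum_tendsto[OF X bound]) (erule single, rule pair)
  ultimately show ?thesis by (simp only: divide_inverse mult.left_neutral mult.commute)
qed

end
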